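(* Let $\mathbb{K}$ be an integral domain. The pair $(\mathfrak{m}\mathsf{Graphs},\overline\zeta_{\mathsf{Graphs}})$ is a combinatorial LC-Hopf algebra, and the unique morphism of combinatorial LC-Hopf algebras $(\mathfrak{m}\mathsf{Graphs},\overline\zeta_{\mathsf{Graphs}})\to(\mathfrak{m}\mathsf{QSym},\overline\zeta_{\mathsf Q})$ assigns to each graph $G$ its kromatic symmetric function $\overline X_G$.
   Context: Linearly compact modules. Give the integral domain $\mathbb{K}$ the discrete topology. A linearly compact (LC) $\mathbb{K}$-module is a $\mathbb{K}$-module $B$ with a bilinear form $\langle\cdot,\cdot\rangle:A\times B\to\mathbb{K}$, for some free $\mathbb{K}$-module $A$, such that $b\mapsto\langle\cdot,b\rangle$ is a bijection $B\to\mathrm{Hom}_{\mathbb{K}}(A,\mathbb{K})$; $B$ has the coarsest topology making all maps $\langle a,\cdot\rangle$ continuous. One says $B$ is the dual of $A$. If $\{a_i\}$ is a basis of $A$, the elements $b_i\in B$ with $\langle a_i,b_j\rangle=\delta_{ij}$ form a pseudobasis of $B$, and elements of $B$ are identified with arbitrary (possibly infinite) formal $\mathbb{K}$-linear combinations of the $b_i$. Morphisms are continuous linear maps, equivalently adjoints of linear maps between the preduals $A$. The completed tensor product is $B\,\overline\otimes\,B'=\mathrm{Hom}_{\mathbb{K}}(A\otimes A',\mathbb{K})$, the LC-module with pseudobasis $\{b_i\otimes b'_j\}$. An LC-algebra (coalgebra, bialgebra, Hopf algebra) is an LC-module $B$ dual to $A$ with continuous linear structure maps that are the adjoints of structure maps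 making $A$ a $\mathbb{K}$-coalgebra (algebra, bialgebra, Hopf algebra). The ring $\mathbb{K}[[t]]$ is an LC-algebra with pseudobasis $\{t^n\}_{n\ge0}$. A combinatorial LC-Hopf algebra is a pair $(H,\zeta)$ with $H$ an LC-Hopf algebra and $\zeta:H\to\mathbb{K}[[t]]$ a homomorphism of LC-algebras (continuous algebra homomorphism) such that $\zeta(\cdot)|_{t\mapsto0}$ is the counit of $H$. A morphism $(H,\zeta)\to(H',\zeta')$ is an LC-Hopf algebra morphism $\Psi$ with $\zeta=\zeta'\circ\Psi$. $\mathfrak{m}\mathsf{QSym}$: the LC-Hopf algebra of quasisymmetric power series in $\mathbb{K}[[x_1,x_2,\dots]]$ of possibly unbounded degree, with pseudobasis $M_\alpha=\sum_{i_1<\dots<i_l}x_{i_1}^{\alpha_1}\cdots x_{i_l}^{\alpha_l}$ ($\alpha$ ranging over compositions, i.e. finite sequences of positive integers), the usual product of power series, coproduct $\Delta(M_\alpha)=\sum_{\alpha=\alpha'\alpha''}M_{\alpha'}\otimes M_{\alpha''}$ (concatenation), and counit setting all $x_i=0$. Define $\overline\zeta_{\mathsf Q}(f)=f(t,0,0,\dots)$. Then $(\mathfrak{m}\mathsf{QSym},\overline\zeta_{\mathsf Q})$ is a combinatorial LC-Hopf algebra, and it is a known result that every combinatorial LC-Hopf algebra has a unique morphism to it. All graphs are finite, simple and undirected. $\mathfrak{m}\mathsf{Graphs}$ is the LC-module with the isomorphism classes of graphs as a pseudobasis, with product given by disjoint union, unit the empty graph, counit $G\mapsto0^{|G|}$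 (with $0^0=1$, $|G|$ the number of vertices), and coproduct $G\mapsto\sum_{S\cup T=V(G)}G|_S\otimes G|_T$ over all not necessarily disjoint decompositions of the vertex set, where $G|_S$ is the induced subgraph. All operations are extended continuously and linearly. $\overline\zeta_{\mathsf{Graphs}}$ is the continuous linear map with $\overline\zeta_{\mathsf{Graphs}}(G)=0^{|E(G)|}t^{|G|}$. Let $\mathsf{Set}(\mathbb{P})$ be the set of finite nonempty subsets of $\mathbb{P}=\{1,2,3,\dots\}$. A proper set-valued coloring of $G$ is a map $\kappa:V(G)\to\mathsf{Set}(\mathbb{P})$ with $\kappa(u)\cap\kappa(v)=\varnothing$ for all $\{u,v\}\in E(G)$. The kromatic symmetric function of $G$ is $\overline X_G=\sum_\kappa\prod_{v\in V(G)}\prod_{j\in\kappa(v)}x_j$, summed over all proper set-valued colorings. *)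

theory Defs
  imports
    "HOL-Analysis.Abstract_Topology"
    "HOL-Library.Poly_Mapping"
    "HOL-Library.Function_Algebras"
    "HOL-Library.FuncSet"
    "HOL-Computational_Algebra.Formal_Power_Series"
begin

section \<open>Free modules with a basis and Hopf algebras on them\<close>

text \<open>
  The free module with basis indexed by \<open>'i\<close> is the type \<open>'i \<Rightarrow>\<^sub>0 'k\<close> of finitely supported
  functions; the tensor product of the modules \<open>'i \<Rightarrow>\<^sub>0 'k\<close> and \<open>'j \<Rightarrow>\<^sub>0 'k\<close> is the module
  \<open>'i \<times> 'j \<Rightarrow>\<^sub>0 'k\<close>.
\<close>

abbreviation basis :: "'i \<Rightarrow> ('i \<Rightarrow>\<^sub>0 'k::zero_neq_one)" where
  "basis i \<equiv> Poly_Mapping.single i 1"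

definition free_scale :: "'k::comm_ring_1 \<Rightarrow> ('i \<Rightarrow>\<^sub>0 'k) \<Rightarrow> ('i \<Rightarrow>\<^sub>0 'k)" where
  "free_scale c = Poly_Mapping.map ((*) c)"

definition lin_ext :: "('i \<Rightarrow> ('j \<Rightarrow>\<^sub>0 'k)) \<Rightarrow> ('i \<Rightarrow>\<^sub>0 'k) \<Rightarrow> ('j \<Rightarrow>\<^sub>0 'k::comm_ring_1)" where
  "lin_ext v a = (\<Sum>i\<in>Poly_Mapping.keys a. free_scale (Poly_Mapping.lookup a i) (v i))"

definition tensor ::
  "('i \<Rightarrow>\<^sub>0 'k) \<Rightarrow> ('j \<Rightarrow>\<^sub>0 'k) \<Rightarrow> ('i \<times> 'j \<Rightarrow>\<^sub>0 'k::comm_ring_1)" where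
  "tensor a b = (\<Sum>i\<in>Poly_Mapping.keys a. \<Sum>j\<in>Poly_Mapping.keys b.
     Poly_Mapping.single (i, j) (Poly_Mapping.lookup a i * Poly_Mapping.lookup b j))"

definition tensor_map ::
  "(('i \<Rightarrow>\<^sub>0 'k) \<Rightarrow> ('p \<Rightarrow>\<^sub>0 'k)) \<Rightarrow> (('j \<Rightarrow>\<^sub>0 'k) \<Rightarrow> ('q \<Rightarrow>\<^sub>0 'k))
    \<Rightarrow> ('i \<times> 'j \<Rightarrow>\<^sub>0 'k) \<Rightarrow> ('p \<times> 'q \<Rightarrow>\<^sub>0 'k::comm_ring_1)" where
  "tensor_map f g = lin_ext (\<lambda>(i, j). tensor (f (basis i)) (g (basis j)))"

definition tensor_assoc ::
  "(('i \<times> 'j) \<times> 'l \<Rightarrow>\<^sub>0 'k) \<Rightarrow> ('i \<times> ('j \<times> 'l) \<Rightarrow>\<^sub>0 'k::comm_ring_1)" where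
  "tensor_assoc = lin_ext (\<lambda>((i, j), l). basis (i, (j, l)))"

definition tensor_middle_swap ::
  "(('i \<times> 'j) \<times> ('p \<times> 'q) \<Rightarrow>\<^sub>0 'k) \<Rightarrow> (('i \<times> 'p) \<times> ('j \<times> 'q) \<Rightarrow>\<^sub>0 'k::comm_ring_1)" where
  "tensor_middle_swap = lin_ext (\<lambda>((i, j), (p, q)). basis ((i, p), (j, q)))"

definition algebra_on_free ::
  "(('i \<times> 'i \<Rightarrow>\<^sub>0 'k) \<Rightarrow> ('i \<Rightarrow>\<^sub>0 'k)) \<Rightarrow> ('i \<Rightarrow>\<^sub>0 'k::comm_ring_1) \<Rightarrow> bool" where
  "algebra_on_free m u \<longleftrightarrow>
     module_hom free_scale free_scale m \<and>
     (\<forall>a b c. m (tensor (m (tensor a b)) c) = m (tensor a (m (tensor b c)))) \<and>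
     (\<forall>a. m (tensor u a) = a) \<and> (\<forall>a. m (tensor a u) = a)"

definition coalgebra_on_free ::
  "(('i \<Rightarrow>\<^sub>0 'k) \<Rightarrow> ('i \<times> 'i \<Rightarrow>\<^sub>0 'k)) \<Rightarrow> (('i \<Rightarrow>\<^sub>0 'k) \<Rightarrow> 'k::comm_ring_1) \<Rightarrow> bool" where
  "coalgebra_on_free d e \<longleftrightarrow>
     module_hom free_scale free_scale d \<and> module_hom free_scale (*) e \<and>
     (\<forall>a. tensor_assoc (tensor_map d id (d a)) = tensor_map id d (d a)) \<and>
     (\<forall>a. lin_ext (\<lambda>(i, j). free_scale (e (basis i)) (basis j)) (d a) = a) \<and>
     (\<forall>a. lin_ext (\<lambda>(i, j). free_scale (e (basis j)) (basis i)) (d a) = a)"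

definition bialgebra_on_free ::
  "(('i \<times> 'i \<Rightarrow>\<^sub>0 'k) \<Rightarrow> ('i \<Rightarrow>\<^sub>0 'k)) \<Rightarrow> ('i \<Rightarrow>\<^sub>0 'k)
    \<Rightarrow> (('i \<Rightarrow>\<^sub>0 'k) \<Rightarrow> ('i \<times> 'i \<Rightarrow>\<^sub>0 'k)) \<Rightarrow> (('i \<Rightarrow>\<^sub>0 'k) \<Rightarrow> 'k::comm_ring_1) \<Rightarrow> bool" where
  "bialgebra_on_free m u d e \<longleftrightarrow>
     algebra_on_free m u \<and> coalgebra_on_free d e \<and>
     d u = tensor u u \<and> e u = 1 \<and>
     (\<forall>a b. e (m (tensor a b)) = e a * e b) \<and>
     (\<forall>a b. d (m (tensor a b)) = tensor_map m m (tensor_middle_swap (tensor (d a) (d b))))"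

definition hopf_algebra_on_free ::
  "(('i \<times> 'i \<Rightarrow>\<^sub>0 'k) \<Rightarrow> ('i \<Rightarrow>\<^sub>0 'k)) \<Rightarrow> ('i \<Rightarrow>\<^sub>0 'k)
    \<Rightarrow> (('i \<Rightarrow>\<^sub>0 'k) \<Rightarrow> ('i \<times> 'i \<Rightarrow>\<^sub>0 'k)) \<Rightarrow> (('i \<Rightarrow>\<^sub>0 'k) \<Rightarrow> 'k::comm_ring_1) \<Rightarrow> bool" where
  "hopf_algebra_on_free m u d e \<longleftrightarrow>
     bialgebra_on_free m u d e \<and>
     (\<exists>S. module_hom free_scale free_scale S \<and>
          (\<forall>a. m (tensor_map S id (d a)) = free_scale (e a) u) \<and>
          (\<forall>a. m (tensor_map id S (d a)) = free_scale (e a) u))"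

section \<open>Linearly compact modules\<close>

text \<open>
  An LC-module is a submodule \<open>lc_carrier\<close> of an abelian group together with its predual
  \<open>'i \<Rightarrow>\<^sub>0 'k\<close> (a free module, with its basis made explicit) and the pairing.
\<close>

record (overloaded) ('i, 'b, 'k) lc_module =
  lc_carrier :: "'b set"
  lc_scale :: "'k \<Rightarrow> 'b \<Rightarrow> 'b"
  lc_pair :: "('i \<Rightarrow>\<^sub>0 'k) \<Rightarrow> 'b \<Rightarrow> 'k"

definition linear_on_carrier ::
  "'b set \<Rightarrow> ('k \<Rightarrow> 'b \<Rightarrow> 'b) \<Rightarrow> ('k \<Rightarrow> 'c \<Rightarrow> 'c) \<Rightarrow> ('b::plus \<Rightarrow> 'c::plus) \<Rightarrow> bool" where
  "linear_on_carrier B s s' f \<longleftrightarrow>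
     (\<forall>x\<in>B. \<forall>y\<in>B. f (x + y) = f x + f y) \<and> (\<forall>c. \<forall>x\<in>B. f (s c x) = s' c (f x))"

definition is_lc_module ::
  "('i, 'b::ab_group_add, 'k::idom, 'z) lc_module_scheme \<Rightarrow> bool" where
  "is_lc_module B \<longleftrightarrow>
     module (lc_scale B) \<and> module.subspace (lc_scale B) (lc_carrier B) \<and>
     (\<forall>a. linear_on_carrier (lc_carrier B) (lc_scale B) (*) (lc_pair B a)) \<and>
     bij_betw (\<lambda>b a. lc_pair B a b) (lc_carrier B) {\<phi>. module_hom free_scale (*) \<phi>}"

definition lc_topology :: "('i, 'b, 'k::zero, 'z) lc_module_scheme \<Rightarrow> 'b topology" where
  "lc_topology B =
     topology_generated_by {{b \<in> lc_carrier B. lc_pair B a b \<in> U} | a U. True}"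

definition lc_continuous_linear ::
  "('i, 'b, 'k::idom, 'z) lc_module_scheme \<Rightarrow> ('j, 'c, 'k, 'y) lc_module_scheme
    \<Rightarrow> ('b::ab_group_add \<Rightarrow> 'c::ab_group_add) \<Rightarrow> bool" where
  "lc_continuous_linear B C f \<longleftrightarrow>
     f ` lc_carrier B \<subseteq> lc_carrier C \<and>
     linear_on_carrier (lc_carrier B) (lc_scale B) (lc_scale C) f \<and>
     continuous_map (lc_topology B) (lc_topology C) f"

definition pseudobasis :: "('i, 'b, 'k::idom, 'z) lc_module_scheme \<Rightarrow> 'i \<Rightarrow> 'b" where
  "pseudobasis B i =
     (THE b. b \<in> lc_carrier B \<and> (\<forall>j. lc_pair B (basis j) b = (if j = i then 1 else 0)))"

text \<open>
  The functions \<open>'i \<Rightarrow> 'k\<close> form the LC-module of formal, possibly infinite, linear combinations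
  of a pseudobasis indexed by \<open>'i\<close>; \<open>delta i\<close> is the pseudobasis element of index \<open>i\<close>. In
  particular, the completed tensor product of LC-modules with pseudobases indexed by \<open>'i\<close> and
  \<open>'j\<close>, i.e. the dual of \<open>'i \<times> 'j \<Rightarrow>\<^sub>0 'k\<close>, is the type \<open>'i \<times> 'j \<Rightarrow> 'k\<close>.
\<close>

definition delta :: "'i \<Rightarrow> 'i \<Rightarrow> 'k::zero_neq_one" where
  "delta i = (\<lambda>j. if j = i then 1 else 0)"

definition std_pair :: "('i \<Rightarrow>\<^sub>0 'k) \<Rightarrow> ('i \<Rightarrow> 'k) \<Rightarrow> 'k::comm_ring_1" where
  "std_pair a \<phi> = (\<Sum>i\<in>Poly_Mapping.keys a. Poly_Mapping.lookup a i * \<phi> i)"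

text \<open>
  \<open>cont_ext v\<close> is the continuous linear extension of \<open>delta i \<mapsto> v i\<close>, i.e. \<open>\<phi> \<mapsto> \<Sum>i. \<phi> i * v i\<close>. It
  exists iff for every \<open>j\<close> only finitely many \<open>v i j\<close> are nonzero.
\<close>

definition cont_ext :: "('i \<Rightarrow> 'j \<Rightarrow> 'k) \<Rightarrow> ('i \<Rightarrow> 'k) \<Rightarrow> ('j \<Rightarrow> 'k::comm_ring_1)" where
  "cont_ext v \<phi> = (\<lambda>j. \<Sum>i | v i j \<noteq> 0. \<phi> i * v i j)"

section \<open>LC-Hopf algebras\<close>

record (overloaded) ('i, 'b, 'k) lc_algebra = "('i, 'b, 'k) lc_module" +
  lc_mult :: "('i \<times> 'i \<Rightarrow> 'k) \<Rightarrow> 'b"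
  lc_one :: 'b

record (overloaded) ('i, 'b, 'k) lc_bialgebra = "('i, 'b, 'k) lc_algebra" +
  lc_comult :: "'b \<Rightarrow> ('i \<times> 'i \<Rightarrow> 'k)"
  lc_counit :: "'b \<Rightarrow> 'k"

text \<open>
  The structure maps are adjoint to those of the predual, with product and coproduct exchanged;
  being adjoints they are automatically continuous and linear. The antipode is not part of the
  data, since it is determined by the bialgebra structure.
\<close>

definition lc_hopf_algebra ::
  "('i, 'b::ab_group_add, 'k::idom, 'z) lc_bialgebra_scheme \<Rightarrow> bool" where
  "lc_hopf_algebra H \<longleftrightarrow>
     is_lc_module H \<and>
     (\<exists>m u d e. hopf_algebra_on_free m u d e \<and>
        (\<forall>\<phi>. lc_mult H \<phi> \<in> lc_carrier H \<and> (\<forall>a. lc_pair H a (lc_mult H \<phi>) = std_pair (d a) \<phi>)) \<and>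
        lc_one H \<in> lc_carrier H \<and> (\<forall>a. lc_pair H a (lc_one H) = e a) \<and>
        (\<forall>b\<in>lc_carrier H. \<forall>x. std_pair x (lc_comult H b) = lc_pair H (m x) b) \<and>
        (\<forall>b\<in>lc_carrier H. lc_counit H b = lc_pair H u b))"

text \<open>
  The completed tensor product of continuous linear maps \<open>f : B \<rightarrow> C\<close> and \<open>g : B' \<rightarrow> C'\<close>, i.e. the
  continuous linear extension of \<open>b\<^sub>i \<otimes> b'\<^sub>j \<mapsto> f b\<^sub>i \<otimes> g b'\<^sub>j\<close>.
\<close>

definition lc_tensor_map ::
  "('i, 'b, 'k, 'z) lc_module_scheme \<Rightarrow> ('p, 'c, 'k, 'y) lc_module_scheme \<Rightarrow>
   ('j, 'b', 'k, 'z') lc_module_scheme \<Rightarrow> ('q, 'c', 'k, 'y') lc_module_scheme \<Rightarrow>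
   ('b \<Rightarrow> 'c) \<Rightarrow> ('b' \<Rightarrow> 'c') \<Rightarrow> ('i \<times> 'j \<Rightarrow> 'k) \<Rightarrow> ('p \<times> 'q \<Rightarrow> 'k::idom)" where
  "lc_tensor_map B C B' C' f g =
     cont_ext (\<lambda>(i, j) (p, q). lc_pair C (basis p) (f (pseudobasis B i)) *
                               lc_pair C' (basis q) (g (pseudobasis B' j)))"

definition lc_algebra_hom ::
  "('i, 'b, 'k::idom, 'z) lc_algebra_scheme \<Rightarrow> ('j, 'c, 'k, 'y) lc_algebra_scheme
    \<Rightarrow> ('b::ab_group_add \<Rightarrow> 'c::ab_group_add) \<Rightarrow> bool" where
  "lc_algebra_hom A B f \<longleftrightarrow>
     lc_continuous_linear A B f \<and>
     (\<forall>\<phi>. f (lc_mult A \<phi>) = lc_mult B (lc_tensor_map A B A B f f \<phi>)) \<and>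
     f (lc_one A) = lc_one B"

definition lc_hopf_morphism ::
  "('i, 'b, 'k::idom, 'z) lc_bialgebra_scheme \<Rightarrow> ('j, 'c, 'k, 'y) lc_bialgebra_scheme
    \<Rightarrow> ('b::ab_group_add \<Rightarrow> 'c::ab_group_add) \<Rightarrow> bool" where
  "lc_hopf_morphism H H' f \<longleftrightarrow>
     lc_algebra_hom H H' f \<and>
     (\<forall>b\<in>lc_carrier H. lc_comult H' (f b) = lc_tensor_map H H' H H' f f (lc_comult H b)) \<and>
     (\<forall>b\<in>lc_carrier H. lc_counit H' (f b) = lc_counit H b)"

definition lc_power_series :: "(nat, 'k fps, 'k::idom) lc_algebra" where
  "lc_power_series =
     \<lparr>lc_carrier = UNIV,
      lc_scale = (\<lambda>c f. fps_const c * f),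
      lc_pair = (\<lambda>a f. std_pair a (fps_nth f)),
      lc_mult = (\<lambda>\<phi>. Abs_fps (cont_ext (\<lambda>(i, j). fps_nth (fps_X ^ i * fps_X ^ j)) \<phi>)),
      lc_one = 1\<rparr>"

definition combinatorial_lc_hopf_algebra ::
  "('i, 'b::ab_group_add, 'k::idom, 'z) lc_bialgebra_scheme \<Rightarrow> ('b \<Rightarrow> 'k fps) \<Rightarrow> bool" where
  "combinatorial_lc_hopf_algebra H \<zeta> \<longleftrightarrow>
     lc_hopf_algebra H \<and> lc_algebra_hom H lc_power_series \<zeta> \<and>
     (\<forall>b\<in>lc_carrier H. fps_nth (\<zeta> b) 0 = lc_counit H b)"

definition combinatorial_lc_hopf_morphism ::
  "('i, 'b::ab_group_add, 'k::idom, 'z) lc_bialgebra_scheme \<Rightarrow> ('b \<Rightarrow> 'k fps)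
    \<Rightarrow> ('j, 'c::ab_group_add, 'k, 'y) lc_bialgebra_scheme \<Rightarrow> ('c \<Rightarrow> 'k fps)
    \<Rightarrow> ('b \<Rightarrow> 'c) \<Rightarrow> bool" where
  "combinatorial_lc_hopf_morphism H \<zeta> H' \<zeta>' \<Psi> \<longleftrightarrow>
     lc_hopf_morphism H H' \<Psi> \<and> (\<forall>b\<in>lc_carrier H. \<zeta> b = \<zeta>' (\<Psi> b))"

section \<open>Quasisymmetric power series\<close>

text \<open>
  A power series in countably many variables is the function assigning to each monomial its
  coefficient; a monomial is given by its exponents. The variables are indexed by \<open>nat\<close>, so that
  index \<open>i\<close> stands for the variable written \<open>x\<^sub>i\<^sub>+\<^sub>1\<close> when counting from one. The pointwise ring
  structure on functions is only used for addition; the product of series is \<^const>\<open>prod_fun\<close>.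
\<close>

type_synonym 'k series = "(nat \<Rightarrow>\<^sub>0 nat) \<Rightarrow> 'k"

typedef composition = "{\<alpha> :: nat list. \<forall>a\<in>set \<alpha>. 0 < a}"
  morphisms parts Composition
  by (rule exI[of _ "[]"]) simp

setup_lifting type_definition_composition

lift_definition comp_append :: "composition \<Rightarrow> composition \<Rightarrow> composition" is "(@)"
  by auto

definition increasing_indices :: "composition \<Rightarrow> nat list set" where
  "increasing_indices \<alpha> = {is. sorted_wrt (<) is \<and> length is = length (parts \<alpha>)}"

definition comp_monomial :: "nat list \<Rightarrow> composition \<Rightarrow> (nat \<Rightarrow>\<^sub>0 nat)" where
  "comp_monomial is \<alpha> = (\<Sum>r<length (parts \<alpha>). Poly_Mapping.single (is ! r) (parts \<alpha> ! r))"

definition quasisymmetric :: "'k series \<Rightarrow> bool" where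
  "quasisymmetric f \<longleftrightarrow>
     (\<forall>\<alpha>. \<forall>is\<in>increasing_indices \<alpha>. \<forall>js\<in>increasing_indices \<alpha>.
        f (comp_monomial is \<alpha>) = f (comp_monomial js \<alpha>))"

text \<open>
  The coefficient of a monomial in an infinite sum of monomials is the number of summands equal
  to it; this number is finite both here and for \<open>kromatic\<close> below.
\<close>

definition monomial_qsym :: "composition \<Rightarrow> 'k::comm_ring_1 series" where
  "monomial_qsym \<alpha> = (\<lambda>x. of_nat (card {is \<in> increasing_indices \<alpha>. comp_monomial is \<alpha> = x}))"

definition qsym_coeff :: "'k series \<Rightarrow> composition \<Rightarrow> 'k" where
  "qsym_coeff f \<alpha> = f (comp_monomial [0..<length (parts \<alpha>)] \<alpha>)"

definition mQSym :: "(composition, 'k series, 'k::idom) lc_bialgebra" where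
  "mQSym =
     \<lparr>lc_carrier = {f. quasisymmetric f},
      lc_scale = (\<lambda>c f x. c * f x),
      lc_pair = (\<lambda>a f. std_pair a (qsym_coeff f)),
      lc_mult = cont_ext (\<lambda>(\<alpha>, \<beta>). prod_fun (monomial_qsym \<alpha>) (monomial_qsym \<beta>)),
      lc_one = (\<lambda>x. if x = 0 then 1 else 0),
      lc_comult = (\<lambda>f. cont_ext
        (\<lambda>\<gamma>. \<Sum>(\<alpha>, \<beta>) | comp_append \<alpha> \<beta> = \<gamma>. delta (\<alpha>, \<beta>)) (qsym_coeff f)),
      lc_counit = (\<lambda>f. f 0)\<rparr>"

definition zeta_Q :: "'k series \<Rightarrow> 'k fps" where
  "zeta_Q f = Abs_fps (\<lambda>n. f (Poly_Mapping.single 0 n))"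

section \<open>Graphs\<close>

text \<open>
  Isomorphism classes of finite graphs do not depend on the supply of vertices as long as it is
  infinite; vertices are taken from \<open>nat\<close>.
\<close>

typedef sgraph =
  "{(V :: nat set, E :: nat set set). finite V \<and> (\<forall>e\<in>E. e \<subseteq> V \<and> card e = 2)}"
  by (rule exI[of _ "({}, {})"]) simp

setup_lifting type_definition_sgraph

lift_definition verts :: "sgraph \<Rightarrow> nat set" is fst .

lift_definition edges :: "sgraph \<Rightarrow> nat set set" is snd .

lift_definition induced_subgraph :: "sgraph \<Rightarrow> nat set \<Rightarrow> sgraph" is
  "\<lambda>(V, E) S. (V \<inter> S, {e \<in> E. e \<subseteq> S})"
  by auto

lift_definition empty_graph :: sgraph is "({}, {})"
  by simp

lift_definition disjoint_union :: "sgraph \<Rightarrow> sgraph \<Rightarrow> sgraph" is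
  "\<lambda>(V, E) (W, F). ((\<lambda>n. 2 * n) ` V \<union> (\<lambda>n. 2 * n + 1) ` W,
                    (`) (\<lambda>n. 2 * n) ` E \<union> (`) (\<lambda>n. 2 * n + 1) ` F)"
proof -
  fix G H :: "nat set \<times> nat set set"
  obtain V E W F where GH: "G = (V, E)" "H = (W, F)" by (metis surj_pair)
  assume "G \<in> {(V, E). finite V \<and> (\<forall>e\<in>E. e \<subseteq> V \<and> card e = 2)}"
    and "H \<in> {(V, E). finite V \<and> (\<forall>e\<in>E. e \<subseteq> V \<and> card e = 2)}"
  then have G: "finite V" "\<And>e. e \<in> E \<Longrightarrow> e \<subseteq> V" "\<And>e. e \<in> E \<Longrightarrow> card e = 2"
    and H: "finite W" "\<And>e. e \<in> F \<Longrightarrow> e \<subseteq> W" "\<And>e. e \<in> F \<Longrightarrow> card e = 2"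
    by (simp_all add: GH)
  have card: "card ((\<lambda>n. 2 * n) ` e) = card e" "card ((\<lambda>n. 2 * n + 1) ` e) = card e"
    for e :: "nat set"
    by (simp_all add: card_image inj_on_def)
  have "e \<subseteq> (\<lambda>n. 2 * n) ` V \<union> (\<lambda>n. 2 * n + 1) ` W \<and> card e = 2"
    if "e \<in> (`) (\<lambda>n. 2 * n) ` E \<union> (`) (\<lambda>n. 2 * n + 1) ` F" for e
    using that
  proof (elim UnE imageE)
    fix d assume "e = (\<lambda>n. 2 * n) ` d" "d \<in> E"
    then show ?thesis by (simp only: card G le_supI1 image_mono simp_thms)
  next
    fix d assume "e = (\<lambda>n. 2 * n + 1) ` d" "d \<in> F"
    then show ?thesis by (simp only: card H le_supI2 image_mono simp_thms)
  qed
  then show "?thesis G H"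
    by (simp only: GH prod.case mem_Collect_eq finite_Un finite_imageI G(1) H(1) simp_thms) simp
qed

definition graph_iso :: "sgraph \<Rightarrow> sgraph \<Rightarrow> bool" where
  "graph_iso G H \<longleftrightarrow> (\<exists>f. bij_betw f (verts G) (verts H) \<and> edges H = (`) f ` edges G)"

lemma edges_subset_verts: "e \<in> edges G \<Longrightarrow> e \<subseteq> verts G"
  using Rep_sgraph[of G] unfolding edges.rep_eq verts.rep_eq by (simp add: case_prod_beta)

lemma equivp_graph_iso: "equivp graph_iso"
proof (rule equivpI)
  show "reflp graph_iso"
    by (rule reflpI) (auto simp: graph_iso_def intro!: exI[of _ id])
  show "symp graph_iso"
  proof (rule sympI)
    fix G H assume "graph_iso G H"
    then obtain f where f: "bij_betw f (verts G) (verts H)" "edges H = (`) f ` edges G"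
      unfolding graph_iso_def by (elim exE conjE)
    have "inv_into (verts G) f ` f ` e = e" if "e \<in> edges G" for e
    proof -
      have "inj_on f (verts G)" using f(1) by (simp add: bij_betw_def)
      then show ?thesis using edges_subset_verts[OF that] by (rule inv_into_image_cancel)
    qed
    then have "edges G = (`) (inv_into (verts G) f) ` edges H"
      by (simp add: f(2) image_image)
    with bij_betw_inv_into[OF f(1)] show "graph_iso H G"
      unfolding graph_iso_def by blast
  qed
  show "transp graph_iso"
  proof (rule transpI)
    fix G H K assume GH: "graph_iso G H" and HK: "graph_iso H K"
    obtain f where f: "bij_betw f (verts G) (verts H)" "edges H = (`) f ` edges G"
      using GH unfolding graph_iso_def by (elim exE conjE)
    obtain g where g: "bij_betw g (verts H) (verts K)" "edges K = (`) g ` edges H"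
      using HK unfolding graph_iso_def by (elim exE conjE)
    have "bij_betw (g \<circ> f) (verts G) (verts K)" by (rule bij_betw_trans[OF f(1) g(1)])
    moreover have "edges K = (`) (g \<circ> f) ` edges G"
      by (simp add: f(2) g(2) image_image comp_def)
    ultimately show "graph_iso G K" unfolding graph_iso_def by blast
  qed
qed

quotient_type graph_class = sgraph / graph_iso
  morphisms class_rep iso_class
  by (rule equivp_graph_iso)

lemma verts_disjoint_union:
  "verts (disjoint_union G H) = (\<lambda>n. 2 * n) ` verts G \<union> (\<lambda>n. 2 * n + 1) ` verts H"
  by transfer auto

lemma edges_disjoint_union:
  "edges (disjoint_union G H) =
     (`) (\<lambda>n. 2 * n) ` edges G \<union> (`) (\<lambda>n. 2 * n + 1) ` edges H"
  by transfer auto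

lemma verts_induced_subgraph: "verts (induced_subgraph G S) = verts G \<inter> S"
  by transfer auto

lemma edges_induced_subgraph: "edges (induced_subgraph G S) = {e \<in> edges G. e \<subseteq> S}"
  by transfer auto

lemma finite_verts: "finite (verts G)"
  by transfer auto

lift_definition class_order :: "graph_class \<Rightarrow> nat" is "\<lambda>G. card (verts G)"
  unfolding graph_iso_def by (elim exE conjE) (rule bij_betw_same_card)

lift_definition class_size :: "graph_class \<Rightarrow> nat" is "\<lambda>G. card (edges G)"
proof -
  fix G H assume "graph_iso G H"
  then obtain f where f: "bij_betw f (verts G) (verts H)" "edges H = (`) f ` edges G"
    unfolding graph_iso_def by (elim exE conjE)
  have "inj_on ((`) f) (edges G)"
  proof (rule inj_onI)
    fix d e assume "d \<in> edges G" "e \<in> edges G" "f ` d = f ` e"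
    then show "d = e"
      using inj_on_image_eq_iff[OF bij_betw_imp_inj_on[OF f(1)]] edges_subset_verts by simp
  qed
  then show "card (edges G) = card (edges H)"
    by (simp add: f(2) card_image)
qed

lift_definition class_union :: "graph_class \<Rightarrow> graph_class \<Rightarrow> graph_class" is disjoint_union
proof -
  fix G G' H H' assume GG': "graph_iso G G'" and HH': "graph_iso H H'"
  obtain f where f: "bij_betw f (verts G) (verts G')" "edges G' = (`) f ` edges G"
    using GG' unfolding graph_iso_def by (elim exE conjE)
  obtain g where g: "bij_betw g (verts H) (verts H')" "edges H' = (`) g ` edges H"
    using HH' unfolding graph_iso_def by (elim exE conjE)
  define h where "h n = (if even n then 2 * f (n div 2) else 2 * g (n div 2) + 1)" for n :: nat
  have h: "h (2 * n) = 2 * f n" "h (2 * n + 1) = 2 * g n + 1" for n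
    by (simp_all add: h_def)
  have "inj_on h (verts (disjoint_union G H))"
  proof (rule inj_onI)
    fix x y assume x: "x \<in> verts (disjoint_union G H)" and y: "y \<in> verts (disjoint_union G H)"
      and eq: "h x = h y"
    have inj: "inj_on f (verts G)" "inj_on g (verts H)"
      using f(1) g(1) by (auto simp: bij_betw_def)
    have same: "a = b" if "a \<in> verts G" "b \<in> verts G" "h (2 * a) = h (2 * b)" for a b
      using that inj_onD[OF inj(1), of a b] by (simp add: h(1))
    have same': "a = b" if "a \<in> verts H" "b \<in> verts H" "h (2 * a + 1) = h (2 * b + 1)" for a b
      using that(3) inj_onD[OF inj(2) _ that(1,2)] unfolding h(2) by simp
    have ne: "h (2 * a) \<noteq> h (2 * b + 1)" for a b
      unfolding h by presburger
    show "x = y"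
      using x y eq same same' ne ne[symmetric] unfolding verts_disjoint_union
      by (elim UnE imageE) metis+
  qed
  moreover have "h ` verts (disjoint_union G H) = verts (disjoint_union G' H')"
  proof -
    have "verts G' = f ` verts G" "verts H' = g ` verts H"
      using f(1) g(1) by (simp_all add: bij_betw_def)
    then show ?thesis
      unfolding verts_disjoint_union by (simp only: image_Un image_image h)
  qed
  ultimately have "bij_betw h (verts (disjoint_union G H)) (verts (disjoint_union G' H'))"
    by (simp add: bij_betw_def)
  moreover have "edges (disjoint_union G' H') = (`) h ` edges (disjoint_union G H)"
    unfolding edges_disjoint_union f(2) g(2) by (simp only: image_Un image_image h)
  ultimately show "graph_iso (disjoint_union G H) (disjoint_union G' H')"
    unfolding graph_iso_def by blast
qed

lemma iso_class_induced_image: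
  assumes "bij_betw f (verts G) (verts H)" "edges H = (`) f ` edges G" "S \<subseteq> verts G"
  shows "iso_class (induced_subgraph H (f ` S)) = iso_class (induced_subgraph G S)"
proof -
  have inj: "inj_on f (verts G)" and im: "f ` verts G = verts H"
    using assms(1) by (auto simp: bij_betw_def)
  have "bij_betw f (verts (induced_subgraph G S)) (verts (induced_subgraph H (f ` S)))"
    using inj im assms(3) unfolding verts_induced_subgraph bij_betw_def
    by (auto intro: inj_on_subset)
  moreover have "f ` e \<subseteq> f ` S \<longleftrightarrow> e \<subseteq> S" if "e \<in> edges G" for e
    using inj_on_image_mem_iff[OF inj _ assms(3)] edges_subset_verts[OF that] by blast
  then have "edges (induced_subgraph H (f ` S)) = (`) f ` edges (induced_subgraph G S)"
    unfolding edges_induced_subgraph assms(2) by auto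
  ultimately have "graph_iso (induced_subgraph G S) (induced_subgraph H (f ` S))"
    unfolding graph_iso_def by blast
  then show ?thesis
    by (simp add: graph_class.abs_eq_iff equivp_symp[OF equivp_graph_iso])
qed

lift_definition class_coproduct ::
  "graph_class \<Rightarrow> (graph_class \<times> graph_class \<Rightarrow> 'k::comm_ring_1)" is
  "\<lambda>G. \<Sum>(S, T) | S \<union> T = verts G.
     delta (iso_class (induced_subgraph G S), iso_class (induced_subgraph G T))"
proof -
  fix G H assume "graph_iso G H"
  then obtain f where f: "bij_betw f (verts G) (verts H)" "edges H = (`) f ` edges G"
    unfolding graph_iso_def by (elim exE conjE)
  let ?g = "inv_into (verts G) f"
  have inj: "inj_on f (verts G)" and im: "f ` verts G = verts H"
    using f(1) by (auto simp: bij_betw_def)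
  have gf: "?g ` f ` S = S" if "S \<subseteq> verts G" for S
    using that inj by (simp add: inv_into_image_cancel)
  have fg: "f ` ?g ` S = S" if "S \<subseteq> verts H" for S
    using that im by (simp add: image_inv_into_cancel)
  have gH: "?g ` verts H = verts G"
    using gf[of "verts G"] im by simp
  show "(\<Sum>(S, T) | S \<union> T = verts G.
            delta (iso_class (induced_subgraph G S), iso_class (induced_subgraph G T)) :: _ \<Rightarrow> 'k) =
        (\<Sum>(S, T) | S \<union> T = verts H.
            delta (iso_class (induced_subgraph H S), iso_class (induced_subgraph H T)))"
  proof (rule sum.reindex_bij_witness[where i = "\<lambda>(S, T). (?g ` S, ?g ` T)"
        and j = "\<lambda>(S, T). (f ` S, f ` T)"], goal_cases)
    case (1 p)
    then obtain S T where p: "p = (S, T)" "S \<union> T = verts G" by auto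
    then have "S \<subseteq> verts G" "T \<subseteq> verts G" by auto
    then show ?case by (simp only: p(1) prod.case gf)
  next
    case (2 p)
    then show ?case by (clarsimp simp: image_Un[symmetric] im)
  next
    case (3 p)
    then obtain S T where p: "p = (S, T)" "S \<union> T = verts H" by auto
    then have "S \<subseteq> verts H" "T \<subseteq> verts H" by auto
    then show ?case by (simp only: p(1) prod.case fg)
  next
    case (4 p)
    then show ?case by (clarsimp simp: image_Un[symmetric] gH)
  next
    case (5 p)
    then obtain S T where p: "p = (S, T)" "S \<union> T = verts G" by auto
    then have "S \<subseteq> verts G" "T \<subseteq> verts G" by auto
    then show ?case by (simp add: p(1) iso_class_induced_image[OF f])
  qed
qed

text \<open>
  \<open>cont_ext\<close> with values in functions on \<open>unit\<close> serves as the extension to maps into \<open>'k\<close>.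
\<close>

definition mGraphs :: "(graph_class, graph_class \<Rightarrow> 'k, 'k::idom) lc_bialgebra" where
  "mGraphs =
     \<lparr>lc_carrier = UNIV,
      lc_scale = (\<lambda>c f C. c * f C),
      lc_pair = std_pair,
      lc_mult = cont_ext (\<lambda>(C, D). delta (class_union C D)),
      lc_one = delta (iso_class empty_graph),
      lc_comult = cont_ext class_coproduct,
      lc_counit = (\<lambda>f. cont_ext (\<lambda>C _. 0 ^ class_order C) f ())\<rparr>"

definition zeta_Graphs :: "(graph_class \<Rightarrow> 'k) \<Rightarrow> 'k::idom fps" where
  "zeta_Graphs f =
     Abs_fps (cont_ext (\<lambda>C. fps_nth (0 ^ class_size C * fps_X ^ class_order C)) f)"

section \<open>The kromatic symmetric function\<close>

definition proper_set_colorings :: "sgraph \<Rightarrow> (nat \<Rightarrow> nat set) set" where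
  "proper_set_colorings G =
     {\<kappa> \<in> verts G \<rightarrow>\<^sub>E {S. finite S \<and> S \<noteq> {}}. \<forall>u v. {u, v} \<in> edges G \<longrightarrow> \<kappa> u \<inter> \<kappa> v = {}}"

definition coloring_monomial :: "sgraph \<Rightarrow> (nat \<Rightarrow> nat set) \<Rightarrow> (nat \<Rightarrow>\<^sub>0 nat)" where
  "coloring_monomial G \<kappa> = (\<Sum>v\<in>verts G. \<Sum>j\<in>\<kappa> v. Poly_Mapping.single j 1)"

definition kromatic :: "sgraph \<Rightarrow> 'k::comm_ring_1 series" where
  "kromatic G = (\<lambda>x. of_nat (card {\<kappa> \<in> proper_set_colorings G. coloring_monomial G \<kappa> = x}))"

end

theory Submission
  imports Defs
begin

text \<open>
  Besides the graphs \<open>G\<close> themselves, the completed module of graphs has the pseudobasis of the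
  elements \<open>\<Gamma>(G) = \<Sum>S\<subseteq>V(G). G|S\<close>, which differ from the graphs by graphs with fewer vertices. These
  elements are group-like, because a pair \<open>(S, T)\<close> of arbitrary vertex sets is a cover of exactly
  one induced subgraph, that on \<open>S \<union> T\<close>; and they multiply like the graphs, \<open>\<Gamma>(G) \<Gamma>(H) = \<Gamma>(G \<squnion> H)\<close>.
  So graphs form a completed monoid algebra.

  On the predual this says the following. Evaluation at the elements \<open>\<Gamma>(G)\<close> sends a functional \<open>F\<close>
  to the function \<open>subset_sum F\<close>; it is injective (\<open>subset_sum_inject\<close>), turns the product
  adjoint to the coproduct of graphs into the pointwise product of functions (\<open>subset_sum_cover\<close>),
  and turns the coproduct of the predual into pullback along the disjoint union. Hence the algebra
  axioms hold because they hold in the ground ring, and the coalgebra axioms hold because the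
  isomorphism classes form a commutative monoid. Product and coproduct are commutative, so the
  antipode only has to be a one-sided inverse of the identity, and such an inverse can be computed
  by recursion on the number of vertices (\<open>antipode_value\<close>).

  For the kromatic symmetric functions, summing over all induced subgraphs amounts to allowing the
  empty set of colors. A coloring is then an independent choice of a stable set for each color, so
  the image of \<open>\<Gamma>(G)\<close> is the group-like series \<open>\<Prod>i. p\<^sub>G(x\<^sub>i)\<close>, where \<open>p\<^sub>G(t) = \<Sum>T stable. t\<^sup>|T|\<close>
  (\<open>subset_sum_kromatic\<close>, stated coefficient by coefficient). All properties of the kromatic
  functions that are needed can be read off from this product and transported back by injectivity:
  quasisymmetry (the product is symmetric in the variables), compatibility with concatenation of
  compositions (disjoint sets of variables contribute independent factors), and multiplicativity
  (\<open>p\<^sub>G\<^sub>\<squnion>\<^sub>H = p\<^sub>G p\<^sub>H\<close>). So the continuous linear map with \<open>G \<mapsto> X\<^sub>G\<close> is a morphism.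

  It is the only one. The coefficient of \<open>M\<^sub>\<alpha>\<^sub>\<beta>\<close> in a quasisymmetric series is the coefficient of
  \<open>M\<^sub>\<alpha> \<otimes> M\<^sub>\<beta>\<close> in its coproduct, so a morphism of coalgebras is determined by the coefficients of
  \<open>M\<^sub>\<alpha>\<close> in its values for compositions \<open>\<alpha>\<close> with at most one part. These are prescribed by the counit
  and the character (\<open>combinatorial_lc_hopf_morphism_unique\<close>).
\<close>

section \<open>Pairing and continuous extension\<close>

lemma std_pair_superset:
  assumes "finite A" "Poly_Mapping.keys a \<subseteq> A"
  shows "std_pair a \<phi> = (\<Sum>i\<in>A. Poly_Mapping.lookup a i * \<phi> i)"
  unfolding std_pair_def using assms
  by (intro sum.mono_neutral_left) (auto simp: in_keys_iff)

lemma std_pair_add_left: "std_pair (a + b) \<phi> = std_pair a \<phi> + std_pair b \<phi>"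
proof -
  let ?A = "Poly_Mapping.keys a \<union> Poly_Mapping.keys b"
  have "Poly_Mapping.keys (a + b) \<subseteq> ?A" by (rule keys_add)
  then show ?thesis
    by (subst (1 2 3) std_pair_superset[of ?A])
      (auto simp: lookup_add distrib_right sum.distrib)
qed

lemma lookup_free_scale [simp]:
  "Poly_Mapping.lookup (free_scale c a) i = c * Poly_Mapping.lookup a i"
  unfolding free_scale_def by (simp add: map.rep_eq when_def)

lemma keys_free_scale: "Poly_Mapping.keys (free_scale c a) \<subseteq> Poly_Mapping.keys a"
  by (auto simp: in_keys_iff)

lemma std_pair_free_scale: "std_pair (free_scale c a) \<phi> = c * std_pair a \<phi>"
  by (subst std_pair_superset[OF _ keys_free_scale])
    (auto simp: std_pair_def sum_distrib_left mult.assoc)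

lemma std_pair_zero_left [simp]: "std_pair 0 \<phi> = 0"
  by (simp add: std_pair_def)

lemma std_pair_sum_left: "std_pair (\<Sum>x\<in>X. a x) \<phi> = (\<Sum>x\<in>X. std_pair (a x) \<phi>)"
  by (induction X rule: infinite_finite_induct) (simp_all add: std_pair_add_left)

lemma std_pair_single [simp]: "std_pair (Poly_Mapping.single i c) \<phi> = c * \<phi> i"
  by (cases "c = 0") (simp_all add: std_pair_def)

lemma std_pair_delta [simp]: "std_pair a (delta i) = Poly_Mapping.lookup a i"
  by (cases "i \<in> Poly_Mapping.keys a")
    (simp_all add: std_pair_def delta_def in_keys_iff if_distrib cong: if_cong)

lemma std_pair_add_right: "std_pair a (\<lambda>i. \<phi> i + \<psi> i) = std_pair a \<phi> + std_pair a \<psi>"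
  by (simp add: std_pair_def distrib_left sum.distrib)

lemma std_pair_scale_right: "std_pair a (\<lambda>i. c * \<phi> i) = c * std_pair a \<phi>"
  by (simp add: std_pair_def sum_distrib_left mult.left_commute)

lemma std_pair_scale_right': "std_pair a (\<lambda>i. \<phi> i * c) = std_pair a \<phi> * c"
  by (simp add: std_pair_def sum_distrib_right mult.assoc)

lemma std_pair_sum_right: "std_pair a (\<lambda>i. \<Sum>x\<in>X. \<phi> x i) = (\<Sum>x\<in>X. std_pair a (\<phi> x))"
  unfolding std_pair_def by (simp add: sum_distrib_left sum.swap[of _ X])

lemma poly_mapping_eq_pairI:
  assumes "\<And>\<phi>. std_pair a \<phi> = std_pair b \<phi>"
  shows "a = b"
  using assms[of "delta _"] by (intro poly_mapping_eqI) simp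

lemma std_pair_lin_ext: "std_pair (lin_ext v a) \<phi> = std_pair a (\<lambda>i. std_pair (v i) \<phi>)"
  by (simp add: lin_ext_def std_pair_sum_left std_pair_free_scale std_pair_def[of a])

lemma std_pair_tensor: "std_pair (tensor a b) \<Phi> = std_pair a (\<lambda>i. std_pair b (\<lambda>j. \<Phi> (i, j)))"
  by (simp add: tensor_def std_pair_sum_left std_pair_def[of a] std_pair_def[of b]
      sum_distrib_left mult.assoc)

lemma std_pair_tensor_map:
  "std_pair (tensor_map f g t) \<Phi> =
     std_pair t (\<lambda>(i, j). std_pair (f (basis i)) (\<lambda>p. std_pair (g (basis j)) (\<lambda>q. \<Phi> (p, q))))"
  by (simp add: tensor_map_def std_pair_lin_ext case_prod_unfold std_pair_tensor)

lemma delta_pair: "delta (i, j) (p, q) = delta i p * (delta j q :: 'k::comm_ring_1)"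
  by (simp add: delta_def)

lemma lookup_tensor [simp]:
  "Poly_Mapping.lookup (tensor a b) (i, j) = Poly_Mapping.lookup a i * Poly_Mapping.lookup b j"
  by (simp add: std_pair_tensor delta_pair std_pair_scale_right std_pair_scale_right'
      flip: std_pair_delta)

lemma lookup_tensor_map:
  "Poly_Mapping.lookup (tensor_map f g t) (p, q) =
     std_pair t (\<lambda>(i, j). Poly_Mapping.lookup (f (basis i)) p * Poly_Mapping.lookup (g (basis j)) q)"
  by (simp add: std_pair_tensor_map delta_pair std_pair_scale_right std_pair_scale_right'
      flip: std_pair_delta)

lemma module_free_scale: "module (free_scale :: 'k::comm_ring_1 \<Rightarrow> ('i \<Rightarrow>\<^sub>0 'k) \<Rightarrow> _)"
  by unfold_locales
    (auto intro!: poly_mapping_eqI simp: lookup_add algebra_simps)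

lemma module_mult: "module ((*) :: 'k::comm_ring_1 \<Rightarrow> 'k \<Rightarrow> 'k)"
  by unfold_locales (auto simp: algebra_simps)

lemma module_hom_pair:
  "module_hom free_scale (*) (\<lambda>a. std_pair a \<phi>)"
  by (intro module_hom.intro module_hom_axioms.intro module_free_scale module_mult)
    (simp_all add: std_pair_add_left std_pair_free_scale)

text \<open>Functionals separate the elements of a free module, so a map with an adjoint is linear.\<close>

lemma module_homI_pair:
  assumes "\<And>a \<phi>. std_pair (f a) \<phi> = std_pair a (F \<phi>)"
  shows "module_hom free_scale free_scale f"
  by (intro module_hom.intro module_hom_axioms.intro module_free_scale poly_mapping_eq_pairI)
    (simp_all add: assms std_pair_add_left std_pair_free_scale)

lemma module_hom_eq_pair:
  assumes "module_hom free_scale (*) \<phi>"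
  shows "\<phi> a = std_pair a (\<lambda>i. \<phi> (basis i))"
proof -
  interpret module_hom free_scale "(*)" \<phi> by (rule assms)
  have "a = (\<Sum>i\<in>Poly_Mapping.keys a. free_scale (Poly_Mapping.lookup a i) (basis i))"
    by (rule poly_mapping_eq_pairI)
      (simp add: std_pair_sum_left std_pair_free_scale, simp add: std_pair_def)
  then have "\<phi> a = \<phi> (\<Sum>i\<in>Poly_Mapping.keys a. free_scale (Poly_Mapping.lookup a i) (basis i))"
    by (rule arg_cong)
  then show ?thesis by (simp add: sum scale std_pair_def)
qed

definition column_finite :: "('i \<Rightarrow> 'j \<Rightarrow> 'k::zero) \<Rightarrow> bool" where
  "column_finite v \<longleftrightarrow> (\<forall>j. finite {i. v i j \<noteq> 0})"

text \<open>
  A column finite family \<open>v\<close> has a continuous extension, and the map of preduals to which that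
  extension is adjoint is given by the transposed matrix.
\<close>

definition predual_map :: "('i \<Rightarrow> 'j \<Rightarrow> 'k) \<Rightarrow> ('j \<Rightarrow>\<^sub>0 'k) \<Rightarrow> ('i \<Rightarrow>\<^sub>0 'k::comm_ring_1)" where
  "predual_map v t = Abs_poly_mapping (\<lambda>i. std_pair t (v i))"

lemma cont_ext_superset:
  assumes "finite A" "{i. v i j \<noteq> 0} \<subseteq> A"
  shows "cont_ext v \<phi> j = (\<Sum>i\<in>A. \<phi> i * v i j)"
  unfolding cont_ext_def using assms by (intro sum.mono_neutral_left) auto

lemma std_pair_neq_0D: "std_pair t \<phi> \<noteq> 0 \<Longrightarrow> \<exists>j\<in>Poly_Mapping.keys t. \<phi> j \<noteq> 0"
  unfolding std_pair_def by (rule ccontr) (simp add: sum.neutral)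

lemma finite_pair_support:
  assumes "column_finite v"
  shows "finite {i. std_pair t (v i) \<noteq> 0}"
proof (rule finite_subset)
  show "{i. std_pair t (v i) \<noteq> 0} \<subseteq> (\<Union>j\<in>Poly_Mapping.keys t. {i. v i j \<noteq> 0})"
    by (auto dest: std_pair_neq_0D)
  show "finite (\<Union>j\<in>Poly_Mapping.keys t. {i. v i j \<noteq> 0})"
    using assms by (auto simp: column_finite_def)
qed

lemma lookup_predual_map:
  "column_finite v \<Longrightarrow> Poly_Mapping.lookup (predual_map v t) i = std_pair t (v i)"
  unfolding predual_map_def
  by (simp add: finite_pair_support)

lemma std_pair_predual_map:
  assumes "column_finite v"
  shows "std_pair (predual_map v t) \<phi> = std_pair t (cont_ext v \<phi>)"
proof -
  let ?I = "\<Union>j\<in>Poly_Mapping.keys t. {i. v i j \<noteq> 0}"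
  have fin: "finite ?I" using assms by (auto simp: column_finite_def)
  have "Poly_Mapping.keys (predual_map v t) \<subseteq> ?I"
    by (auto simp: in_keys_iff[of _ "predual_map v t"] lookup_predual_map[OF assms]
        dest: std_pair_neq_0D)
  then have "std_pair (predual_map v t) \<phi> =
      (\<Sum>i\<in>?I. \<Sum>j\<in>Poly_Mapping.keys t. Poly_Mapping.lookup t j * v i j * \<phi> i)"
    by (subst std_pair_superset[OF fin])
      (simp_all add: lookup_predual_map[OF assms] std_pair_def sum_distrib_right)
  also have "\<dots> = (\<Sum>j\<in>Poly_Mapping.keys t. Poly_Mapping.lookup t j * (\<Sum>i\<in>?I. \<phi> i * v i j))"
    by (subst sum.swap) (simp add: sum_distrib_left mult_ac)
  also have "\<dots> = std_pair t (cont_ext v \<phi>)"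
    unfolding std_pair_def
    by (intro sum.cong refl arg_cong2[where f = "(*)"] cont_ext_superset[OF fin, symmetric]) auto
  finally show ?thesis .
qed

lemma module_hom_predual_map:
  "column_finite v \<Longrightarrow> module_hom free_scale free_scale (predual_map v)"
  by (rule module_homI_pair) (rule std_pair_predual_map)

lemma cont_ext_eq_pair:
  assumes "column_finite v"
  shows "cont_ext v \<phi> j = std_pair (predual_map v (basis j)) \<phi>"
  by (simp add: std_pair_predual_map[OF assms])

lemma cont_ext_delta:
  assumes "column_finite v"
  shows "cont_ext v (delta i) = v i"
  by (simp add: fun_eq_iff cont_ext_eq_pair assms lookup_predual_map)

lemma cont_ext_add:
  "cont_ext v (\<phi> + \<psi>) j = cont_ext v \<phi> j + cont_ext v \<psi> j"
  by (simp add: cont_ext_def distrib_right sum.distrib)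

lemma cont_ext_scale: "cont_ext v (\<lambda>i. c * \<phi> i) j = c * cont_ext v \<phi> j"
  by (simp add: cont_ext_def sum_distrib_left mult.assoc)

text \<open>
  The composite of two adjoint maps is adjoint to the composite of the maps of preduals, which
  turns a statement about infinite sums into one about finite ones. This is the rule by which
  identities between continuous maps are reduced to their values on a pseudobasis.
\<close>

lemma cont_ext_cont_ext:
  assumes v: "column_finite v" and w: "column_finite w"
  shows "cont_ext w (cont_ext v \<phi>) = cont_ext (\<lambda>i. cont_ext w (v i)) \<phi>"
    and "column_finite (\<lambda>i. cont_ext w (v i))"
proof -
  have eq: "(\<lambda>i. cont_ext w (v i) j) = Poly_Mapping.lookup (predual_map v (predual_map w (basis j)))"
    for j
    by (simp add: fun_eq_iff lookup_predual_map v cont_ext_eq_pair[OF w])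
  then show col: "column_finite (\<lambda>i. cont_ext w (v i))"
    unfolding column_finite_def by (auto simp: fun_eq_iff)
  have "predual_map (\<lambda>i. cont_ext w (v i)) (basis j) = predual_map v (predual_map w (basis j))" for j
    by (rule poly_mapping_eqI) (simp add: lookup_predual_map[OF col] fun_cong[OF eq])
  then show "cont_ext w (cont_ext v \<phi>) = cont_ext (\<lambda>i. cont_ext w (v i)) \<phi>"
    by (simp add: fun_eq_iff cont_ext_eq_pair[OF col] std_pair_predual_map v w)
qed

section \<open>Continuous linear maps\<close>

text \<open>
  The topology of an LC-module is the initial one for the functionals \<open>lc_pair C a\<close>, so a map is
  continuous once every such functional pulls back to a functional of the same kind.
\<close>

lemma continuous_map_lc_adjoint:
  assumes img: "f ` lc_carrier B \<subseteq> lc_carrier C"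
    and adj: "\<And>a. \<exists>a'. \<forall>b\<in>lc_carrier B. lc_pair C a (f b) = lc_pair B a' b"
  shows "continuous_map (lc_topology B) (lc_topology C) f"
proof -
  have union: "\<Union> {{b \<in> lc_carrier B. lc_pair B a b \<in> U} |a U. True} = lc_carrier B"
    for B :: "('x, 'y, 'z::zero, 'w) lc_module_scheme"
    \<comment> \<open>For \<open>U = UNIV\<close> the generating set is the whole carrier.\<close>
    by (intro equalityI Union_least subsetI UnionI[of "{b \<in> lc_carrier B. lc_pair B undefined b \<in> UNIV}"])
      auto
  have top: "topspace (lc_topology B) = lc_carrier B" for B :: "('x, 'y, 'z::zero, 'w) lc_module_scheme"
    unfolding lc_topology_def topology_generated_by_topspace by (rule union)
  show ?thesis
    unfolding lc_topology_def[of C]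
  proof (rule continuous_on_generated_topo)
    show "f ` topspace (lc_topology B) \<subseteq> \<Union> {{b \<in> lc_carrier C. lc_pair C a b \<in> U} |a U. True}"
      unfolding top union by (rule img)
    fix V assume "V \<in> {{b \<in> lc_carrier C. lc_pair C a b \<in> U} |a U. True}"
    then obtain a U where V: "V = {b \<in> lc_carrier C. lc_pair C a b \<in> U}" by blast
    obtain a' where a': "\<And>b. b \<in> lc_carrier B \<Longrightarrow> lc_pair C a (f b) = lc_pair B a' b"
      using adj by metis
    have "f -` V \<inter> topspace (lc_topology B) = {b \<in> lc_carrier B. lc_pair B a' b \<in> U}"
    proof (rule set_eqI)
      fix x
      show "x \<in> f -` V \<inter> topspace (lc_topology B) \<longleftrightarrow> x \<in> {b \<in> lc_carrier B. lc_pair B a' b \<in> U}"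
        using img a'[of x] unfolding top V by (cases "x \<in> lc_carrier B") (simp_all add: image_subset_iff)
    qed
    then show "openin (lc_topology B) (f -` V \<inter> topspace (lc_topology B))"
      unfolding lc_topology_def by (simp only:) (rule topology_generated_by_Basis, blast)
  qed
qed

section \<open>Graphs and their isomorphism classes\<close>

lemma sgraph_eqI: "verts G = verts H \<Longrightarrow> edges G = edges H \<Longrightarrow> G = H"
  by (simp add: verts.rep_eq edges.rep_eq prod_eq_iff flip: Rep_sgraph_inject)

lemma induced_subgraph_whole: "verts G \<subseteq> S \<Longrightarrow> induced_subgraph G S = G"
  using edges_subset_verts[of _ G]
  by (intro sgraph_eqI) (auto simp: verts_induced_subgraph edges_induced_subgraph)

lemma induced_subgraph_induced:
  "induced_subgraph (induced_subgraph G S) T = induced_subgraph G (S \<inter> T)"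
  by (intro sgraph_eqI) (auto simp: verts_induced_subgraph edges_induced_subgraph)

lemma iso_class_eqI:
  assumes "inj_on f (verts G)" "f ` verts G = verts H" "(`) f ` edges G = edges H"
  shows "iso_class G = iso_class H"
  unfolding graph_class.abs_eq_iff graph_iso_def
  by (intro exI[of _ f]) (simp add: bij_betw_def assms)

lemma class_order_iso_class [simp]: "class_order (iso_class G) = card (verts G)"
  by (rule class_order.abs_eq)

lemma class_size_iso_class [simp]: "class_size (iso_class G) = card (edges G)"
  by (rule class_size.abs_eq)

lemma class_union_iso_class [simp]:
  "class_union (iso_class G) (iso_class H) = iso_class (disjoint_union G H)"
  by (rule class_union.abs_eq)

lemma iso_class_cases: obtains G where "C = iso_class G"
  by (metis Quotient_graph_class Quotient_abs_rep)

lemma finite_edges: "finite (edges G)"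
  using edges_subset_verts[of _ G]
  by (intro finite_subset[of "edges G" "Pow (verts G)"]) (auto simp: finite_verts)

lemma verts_empty_graph [simp]: "verts empty_graph = {}"
  by transfer simp

lemma edges_empty_graph [simp]: "edges empty_graph = {}"
  by transfer simp

lemma edge_nonempty: "e \<in> edges G \<Longrightarrow> e \<noteq> {}"
  using Rep_sgraph[of G] by (auto simp: edges.rep_eq case_prod_unfold)

lemma graph_eq_empty: "verts G = {} \<Longrightarrow> G = empty_graph"
  using edges_subset_verts[of _ G] edge_nonempty[of _ G] by (intro sgraph_eqI) auto

lemma class_order_eq_0 [simp]: "class_order C = 0 \<longleftrightarrow> C = iso_class empty_graph"
proof (cases C rule: iso_class_cases)
  case (1 G)
  show ?thesis
  proof
    assume "class_order C = 0"
    then have "verts G = {}" by (simp add: 1 finite_verts)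
    then show "C = iso_class empty_graph" using graph_eq_empty[of G] 1 by simp
  qed simp
qed

lemma finite_graphs_verts_subset:
  assumes "finite V"
  shows "finite {G. verts G \<subseteq> V}"
proof (rule finite_imageD)
  have "edges G \<subseteq> Pow V" if "verts G \<subseteq> V" for G
    using edges_subset_verts[of _ G] that by blast
  then have "(\<lambda>G. (verts G, edges G)) ` {G. verts G \<subseteq> V} \<subseteq> Pow V \<times> Pow (Pow V)"
    by blast
  then show "finite ((\<lambda>G. (verts G, edges G)) ` {G. verts G \<subseteq> V})"
    by (rule finite_subset) (simp add: assms)
  show "inj_on (\<lambda>G. (verts G, edges G)) {G. verts G \<subseteq> V}"
    by (auto intro: inj_onI sgraph_eqI)
qed

lemma iso_class_relabel:
  assumes "inj_on f (verts G)"
  obtains H where "verts H = f ` verts G" "edges H = (`) f ` edges G" "iso_class H = iso_class G"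
proof -
  have card2: "e \<subseteq> verts G \<and> card e = 2" if "e \<in> edges G" for e
    using that Rep_sgraph[of G] by (auto simp: verts.rep_eq edges.rep_eq case_prod_unfold)
  have "card (f ` e) = 2" if "e \<in> edges G" for e
    using card2[OF that] inj_on_subset[OF assms] by (simp add: card_image)
  then have "(f ` verts G, (`) f ` edges G) \<in> {(V, E). finite V \<and> (\<forall>e\<in>E. e \<subseteq> V \<and> card e = 2)}"
    using card2 by (auto simp: finite_verts)
  then have H: "Rep_sgraph (Abs_sgraph (f ` verts G, (`) f ` edges G)) = (f ` verts G, (`) f ` edges G)"
    by (rule Abs_sgraph_inverse)
  define H where "H = Abs_sgraph (f ` verts G, (`) f ` edges G)"
  have "verts H = f ` verts G" "edges H = (`) f ` edges G"
    by (simp_all only: verts.rep_eq[of H] edges.rep_eq[of H] H[folded H_def] fst_conv snd_conv)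
  then show thesis
    using that[of H] iso_class_eqI[OF assms, of H] by simp
qed

lemma finite_class_order_le: "finite {C. class_order C \<le> n}"
proof (rule finite_subset)
  show "{C. class_order C \<le> n} \<subseteq> iso_class ` {G. verts G \<subseteq> {..<n}}"
  proof
    fix C assume C: "C \<in> {C. class_order C \<le> n}"
    obtain G where G: "C = iso_class G" by (rule iso_class_cases)
    obtain f where f: "bij_betw f (verts G) {..<card (verts G)}"
      using ex_bij_betw_finite_nat[OF finite_verts, of G] by (auto simp: atLeast0LessThan)
    obtain H where H: "verts H = f ` verts G" "iso_class H = iso_class G"
      using iso_class_relabel[OF bij_betw_imp_inj_on[OF f]] by metis
    have "verts H = {..<card (verts G)}"
      using bij_betw_imp_surj_on[OF f] H(1) by simp
    moreover have "card (verts G) \<le> n"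
      using C G by simp
    ultimately have "verts H \<subseteq> {..<n}" by simp
    then show "C \<in> iso_class ` {G. verts G \<subseteq> {..<n}}"
      using H(2) G by (intro image_eqI[of _ _ H]) simp_all
  qed
  show "finite (iso_class ` {G. verts G \<subseteq> {..<n}})"
    by (intro finite_imageI finite_graphs_verts_subset) simp
qed

text \<open>
  The vertices that \<open>S\<close> and \<open>T\<close> contribute to a disjoint union, whose vertices are numbered by
  even numbers for the first graph and by odd numbers for the second. Every set of numbers arises
  from exactly one pair \<open>(S, T)\<close>, so sums over vertex sets of a disjoint union are double sums.
\<close>

definition join_sets :: "nat set \<Rightarrow> nat set \<Rightarrow> nat set" where
  "join_sets S T = (\<lambda>n. 2 * n) ` S \<union> (\<lambda>n. 2 * n + 1) ` T"

lemma mem_join_sets [simp]: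
  "2 * n \<in> join_sets S T \<longleftrightarrow> n \<in> S" "Suc (2 * n) \<in> join_sets S T \<longleftrightarrow> n \<in> T"
  unfolding join_sets_def by (auto, presburger+)

lemma mem_join_sets_iff:
  "x \<in> join_sets S T \<longleftrightarrow> (if even x then x div 2 \<in> S else x div 2 \<in> T)"
  by (cases "even x") (auto elim!: evenE oddE)

lemma join_sets_subset_iff [simp]: "join_sets S T \<subseteq> join_sets S' T' \<longleftrightarrow> S \<subseteq> S' \<and> T \<subseteq> T'"
proof
  assume *: "join_sets S T \<subseteq> join_sets S' T'"
  show "S \<subseteq> S' \<and> T \<subseteq> T'"
    using subsetD[OF *, of "2 * _"] subsetD[OF *, of "Suc (2 * _)"] by auto
next
  assume "S \<subseteq> S' \<and> T \<subseteq> T'"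
  then show "join_sets S T \<subseteq> join_sets S' T'" unfolding join_sets_def by blast
qed

lemma join_sets_eq_iff [simp]: "join_sets S T = join_sets S' T' \<longleftrightarrow> S = S' \<and> T = T'"
  by (auto simp: set_eq_subset[of "join_sets _ _"])

lemma join_sets_Un: "join_sets S T \<union> join_sets S' T' = join_sets (S \<union> S') (T \<union> T')"
  by (auto simp: join_sets_def)

lemma join_sets_Int: "join_sets S T \<inter> join_sets S' T' = join_sets (S \<inter> S') (T \<inter> T')"
  by (auto simp: mem_join_sets_iff split: if_splits)

lemma join_sets_vimage [simp]: "join_sets {n. 2 * n \<in> U} {n. Suc (2 * n) \<in> U} = U"
  by (auto simp: mem_join_sets_iff elim!: evenE oddE split: if_splits)

lemma verts_disjoint_union_join: "verts (disjoint_union G H) = join_sets (verts G) (verts H)"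
  by (simp add: verts_disjoint_union join_sets_def)

lemma induced_disjoint_union:
  "induced_subgraph (disjoint_union G H) (join_sets S T) =
     disjoint_union (induced_subgraph G S) (induced_subgraph H T)"
proof (rule sgraph_eqI)
  have "(\<lambda>n. 2 * n) ` e \<subseteq> join_sets S T \<longleftrightarrow> e \<subseteq> S"
    "(\<lambda>n. 2 * n + 1) ` e \<subseteq> join_sets S T \<longleftrightarrow> e \<subseteq> T" for e
    by auto
  then show "edges (induced_subgraph (disjoint_union G H) (join_sets S T)) =
      edges (disjoint_union (induced_subgraph G S) (induced_subgraph H T))"
    by (auto simp: edges_induced_subgraph edges_disjoint_union)
qed (simp add: verts_induced_subgraph verts_disjoint_union_join join_sets_Int)

lemma card_join_sets: "finite S \<Longrightarrow> finite T \<Longrightarrow> card (join_sets S T) = card S + card T"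
  unfolding join_sets_def
  by (subst card_Un_disjoint) (auto simp: card_image inj_on_def, presburger)

lemma class_order_union: "class_order (class_union C D) = class_order C + class_order D"
  by (cases C rule: iso_class_cases; cases D rule: iso_class_cases)
    (simp add: verts_disjoint_union_join card_join_sets finite_verts)

lemma card_edges_disjoint_union:
  "card (edges (disjoint_union G H)) = card (edges G) + card (edges H)"
proof -
  have "(`) (\<lambda>n. 2 * n) ` edges G \<inter> (`) (\<lambda>n. 2 * n + 1) ` edges H = {}"
  proof -
    have "(\<lambda>n. 2 * n) ` d \<noteq> (\<lambda>n. 2 * n + 1) ` e" if d: "d \<in> edges G" for d e :: "nat set"
    proof
      assume eq: "(\<lambda>n. 2 * n) ` d = (\<lambda>n. 2 * n + 1) ` e"
      obtain n where "n \<in> d" using edge_nonempty[OF d] by blast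
      then have "2 * n \<in> (\<lambda>n. 2 * n + 1) ` e" unfolding eq[symmetric] by (rule imageI)
      then show False by (auto, presburger)
    qed
    then show ?thesis by blast
  qed
  moreover have "card ((`) (\<lambda>n::nat. 2 * n) ` E) = card E" "card ((`) (\<lambda>n::nat. 2 * n + 1) ` E) = card E"
    for E :: "nat set set"
    by (auto intro!: card_image inj_on_image simp: inj_on_def)
  ultimately show ?thesis
    by (simp add: edges_disjoint_union card_Un_disjoint finite_edges)
qed

lemma class_size_union: "class_size (class_union C D) = class_size C + class_size D"
  by (cases C rule: iso_class_cases; cases D rule: iso_class_cases)
    (simp add: card_edges_disjoint_union)

lemma class_union_commute: "class_union C D = class_union D C"
proof (cases C rule: iso_class_cases; cases D rule: iso_class_cases)
  fix G H assume CD: "C = iso_class G" "D = iso_class H"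
  \<comment> \<open>exchanges the even and the odd vertex numbers\<close>
  define f :: "nat \<Rightarrow> nat" where "f n = (if even n then n + 1 else n - 1)" for n
  have f: "f (2 * n) = 2 * n + 1" "f (2 * n + 1) = 2 * n" for n
    by (simp_all add: f_def)
  have "f (f n) = n" for n by (cases "even n") (auto simp: f_def)
  then have "inj f" by (metis injI)
  have "iso_class (disjoint_union G H) = iso_class (disjoint_union H G)"
    by (rule iso_class_eqI[of f])
      (auto simp only: inj_on_subset[OF \<open>inj f\<close>] subset_UNIV verts_disjoint_union
        edges_disjoint_union image_Un image_image f)
  then show ?thesis by (simp add: CD)
qed

lemma class_union_assoc: "class_union (class_union B C) D = class_union B (class_union C D)"
proof (cases B rule: iso_class_cases; cases C rule: iso_class_cases; cases D rule: iso_class_cases)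
  fix F G H assume BCD: "B = iso_class F" "C = iso_class G" "D = iso_class H"
  \<comment> \<open>A vertex \<open>n\<close> of the three graphs has the number \<open>4 n\<close>, \<open>4 n + 2\<close> or \<open>2 n + 1\<close> on the left
      and \<open>2 n\<close>, \<open>4 n + 1\<close> or \<open>4 n + 3\<close> on the right; \<open>g\<close> is the inverse renumbering.\<close>
  define f :: "nat \<Rightarrow> nat" where
    "f n = (if n mod 4 = 0 then n div 2 else if n mod 4 = 2 then n - 1 else 2 * n + 1)" for n
  have f: "f (2 * (2 * n)) = 2 * n" "f (2 * (2 * n + 1)) = 2 * (2 * n) + 1"
    "f (2 * n + 1) = 2 * (2 * n + 1) + 1" for n
    by (simp_all add: f_def) presburger+
  define g :: "nat \<Rightarrow> nat" where
    "g n = (if even n then 2 * n else if n mod 4 = 1 then n + 1 else n div 2)" for n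
  have g: "g (2 * n) = 2 * (2 * n)" "g (2 * (2 * n) + 1) = 2 * (2 * n + 1)"
    "g (2 * (2 * n + 1) + 1) = 2 * n + 1" for n
    by (simp_all add: g_def)
  have "g (f n) = n" for n
  proof -
    consider k where "n = 2 * (2 * k)" | k where "n = 2 * (2 * k + 1)" | k where "n = 2 * k + 1"
      by (metis evenE oddE)
    then show ?thesis by cases (simp_all only: f g)
  qed
  then have "inj f" by (rule inj_on_inverseI)
  have "iso_class (disjoint_union (disjoint_union F G) H) =
        iso_class (disjoint_union F (disjoint_union G H))"
    by (rule iso_class_eqI[of f])
      (auto simp only: inj_on_subset[OF \<open>inj f\<close>] subset_UNIV verts_disjoint_union
        edges_disjoint_union image_Un image_image f Un_assoc)
  then show ?thesis by (simp add: BCD)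
qed

lemma class_union_empty [simp]:
  "class_union C (iso_class empty_graph) = C" "class_union (iso_class empty_graph) C = C"
proof -
  show "class_union C (iso_class empty_graph) = C"
  proof (cases C rule: iso_class_cases)
    case (1 G)
    have "iso_class G = iso_class (disjoint_union G empty_graph)"
      by (rule iso_class_eqI[of "\<lambda>n. 2 * n"])
        (auto simp: inj_on_def verts_disjoint_union edges_disjoint_union)
    then show ?thesis unfolding 1 class_union_iso_class by (rule sym)
  qed
  then show "class_union (iso_class empty_graph) C = C" by (simp add: class_union_commute)
qed

section \<open>Sums over induced subgraphs\<close>

text \<open>
  The value of the functional \<open>F\<close> at the group-like element \<open>\<Sum>S\<subseteq>V(G). G|S\<close>.
\<close>

definition subset_sum :: "(sgraph \<Rightarrow> 'a) \<Rightarrow> sgraph \<Rightarrow> 'a::comm_ring_1" where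
  "subset_sum F G = (\<Sum>S\<in>Pow (verts G). F (induced_subgraph G S))"

text \<open>
  The value of \<open>F\<close>, as a functional on pairs of graphs, at the coproduct of \<open>G\<close>.
\<close>

definition cover_sum :: "(sgraph \<Rightarrow> sgraph \<Rightarrow> 'a) \<Rightarrow> sgraph \<Rightarrow> 'a::comm_ring_1" where
  "cover_sum F G =
     (\<Sum>(S, T) | S \<union> T = verts G. F (induced_subgraph G S) (induced_subgraph G T))"

lemma finite_covers: "finite {(S, T). S \<union> T = verts G}"
  by (rule finite_subset[of _ "Pow (verts G) \<times> Pow (verts G)"]) (auto simp: finite_verts)

lemma verts_induced_subset: "S \<subseteq> verts G \<Longrightarrow> verts (induced_subgraph G S) = S"
  by (auto simp: verts_induced_subgraph)

lemma subset_sum_remove: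
  "subset_sum F G = F G + (\<Sum>S | S \<subset> verts G. F (induced_subgraph G S))"
proof -
  have "Pow (verts G) - {verts G} = {S. S \<subset> verts G}" by auto
  then show ?thesis
    unfolding subset_sum_def
    by (subst sum.remove[of _ "verts G"]) (auto simp: finite_verts induced_subgraph_whole)
qed

text \<open>
  The summand for the full vertex set is \<open>F G\<close> itself and the others belong to smaller graphs,
  so \<open>F\<close> can be recovered from its subset sums; invariance under isomorphism is inherited.
\<close>

lemma subset_sum_inject:
  assumes "\<And>G. subset_sum F G = subset_sum F' G"
  shows "F G = F' G"
proof (induction "card (verts G)" arbitrary: G rule: less_induct)
  case less
  have "F (induced_subgraph G S) = F' (induced_subgraph G S)" if "S \<subset> verts G" for S
    using that less psubset_card_mono[OF finite_verts that]
    by (simp add: verts_induced_subset psubset_imp_subset)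
  then show ?case
    using assms[of G] by (simp add: subset_sum_remove)
qed

lemma iso_invariant_subset_sum:
  assumes "\<And>G H. iso_class G = iso_class H \<Longrightarrow> subset_sum F G = subset_sum F H"
    and "iso_class G = iso_class H"
  shows "F G = F H"
  using assms(2)
proof (induction "card (verts G)" arbitrary: G H rule: less_induct)
  case less
  obtain f where f: "bij_betw f (verts G) (verts H)" "edges H = (`) f ` edges G"
    using less.prems unfolding graph_class.abs_eq_iff graph_iso_def by blast
  have inj: "inj_on f (verts G)" and img: "f ` verts G = verts H"
    using f(1) by (auto simp: bij_betw_def)
  have bij: "bij_betw ((`) f) {S. S \<subset> verts G} {S. S \<subset> verts H}"
  proof -
    have "bij_betw ((`) f) (Pow (verts G)) (Pow (verts H))"
      using f(1) by (rule bij_betw_Pow)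
    then have "bij_betw ((`) f) (Pow (verts G) - {verts G}) (Pow (verts H) - {f ` verts G})"
      by (rule bij_betw_DiffI) (auto simp: bij_betw_def img)
    moreover have "Pow A - {A} = {S. S \<subset> A}" for A :: "nat set" by auto
    ultimately show ?thesis by (simp add: img)
  qed
  have "F (induced_subgraph G S) = F (induced_subgraph H (f ` S))" if "S \<subset> verts G" for S
  proof (rule less.hyps)
    show "card (verts (induced_subgraph G S)) < card (verts G)"
      using psubset_card_mono[OF finite_verts that] that
      by (simp add: verts_induced_subset psubset_imp_subset)
    show "iso_class (induced_subgraph G S) = iso_class (induced_subgraph H (f ` S))"
      using iso_class_induced_image[OF f] that by simp
  qed
  then have "(\<Sum>S | S \<subset> verts G. F (induced_subgraph G S)) =
             (\<Sum>S | S \<subset> verts H. F (induced_subgraph H S))"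
    using sum.reindex_bij_betw[OF bij, of "\<lambda>S. F (induced_subgraph H S)"] by simp
  then show ?case
    using assms(1)[OF less.prems] by (simp add: subset_sum_remove)
qed

text \<open>
  This is why \<open>\<Sum>S\<subseteq>V(G). G|S\<close> is group-like: every pair \<open>(S, T)\<close> of subsets of \<open>V(G)\<close> covers
  exactly one induced subgraph of \<open>G\<close>.
\<close>

lemma subset_sum_cover:
  "subset_sum (cover_sum F) G =
     (\<Sum>S\<in>Pow (verts G). \<Sum>T\<in>Pow (verts G). F (induced_subgraph G S) (induced_subgraph G T))"
proof -
  have "cover_sum F (induced_subgraph G U) =
      (\<Sum>(S, T) | S \<union> T = U. F (induced_subgraph G S) (induced_subgraph G T))"
    if "U \<subseteq> verts G" for U
    unfolding cover_sum_def using that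
    by (intro sum.cong) (auto simp: verts_induced_subset induced_subgraph_induced Int_absorb1)
  then have "subset_sum (cover_sum F) G =
      (\<Sum>U\<in>Pow (verts G). \<Sum>p | fst p \<union> snd p = U.
         F (induced_subgraph G (fst p)) (induced_subgraph G (snd p)))"
    by (simp add: subset_sum_def case_prod_unfold)
  also have "\<dots> = (\<Sum>(S, T)\<in>Pow (verts G) \<times> Pow (verts G).
      F (induced_subgraph G S) (induced_subgraph G T))"
  proof (subst sum.Sigma)
    show "\<forall>U\<in>Pow (verts G). finite {p. fst p \<union> snd p = U}"
    proof
      fix U assume "U \<in> Pow (verts G)"
      then show "finite {p. fst p \<union> snd p = U}"
        using finite_covers[of "induced_subgraph G U"]
        by (simp add: verts_induced_subset case_prod_unfold)
    qed
    show "(\<Sum>(U, p)\<in>(SIGMA U:Pow (verts G). {p. fst p \<union> snd p = U}).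
           F (induced_subgraph G (fst p)) (induced_subgraph G (snd p))) =
        (\<Sum>(S, T)\<in>Pow (verts G) \<times> Pow (verts G). F (induced_subgraph G S) (induced_subgraph G T))"
      by (rule sum.reindex_bij_witness[where i = "\<lambda>p. (fst p \<union> snd p, p)" and j = snd]) auto
  qed (simp add: finite_verts)
  finally show ?thesis by (simp add: sum.cartesian_product)
qed

text \<open>
  This is why the group-like elements multiply like the graphs: a set of vertices of a disjoint
  union is a pair of sets of vertices.
\<close>

lemma subset_sum_disjoint_union:
  "subset_sum F (disjoint_union G H) =
     subset_sum (\<lambda>G'. subset_sum (\<lambda>H'. F (disjoint_union G' H')) H) G"
proof -
  have "subset_sum F (disjoint_union G H) =
      (\<Sum>(S, T)\<in>Pow (verts G) \<times> Pow (verts H).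
         F (disjoint_union (induced_subgraph G S) (induced_subgraph H T)))"
    unfolding subset_sum_def
    by (rule sum.reindex_bij_witness[where j = "\<lambda>U. ({n. 2 * n \<in> U}, {n. Suc (2 * n) \<in> U})"
          and i = "\<lambda>(S, T). join_sets S T"])
      (auto simp: verts_disjoint_union_join simp flip: induced_disjoint_union
        intro: subsetD[OF join_sets_subset_iff[THEN iffD2]])
  then show ?thesis by (simp add: subset_sum_def sum.cartesian_product)
qed

text \<open>
  The compatibility of product and coproduct: a disjoint union is covered by covering each of the
  two graphs.
\<close>

lemma cover_sum_disjoint_union:
  "cover_sum F (disjoint_union G H) =
     cover_sum (\<lambda>G' G''. cover_sum (\<lambda>H' H''. F (disjoint_union G' H') (disjoint_union G'' H'')) H) G"
proof -
  let ?even = "\<lambda>U. {n. 2 * n \<in> (U :: nat set)}" and ?odd = "\<lambda>U. {n. Suc (2 * n) \<in> (U :: nat set)}"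
  have Un: "S \<union> T = join_sets V W \<longleftrightarrow> ?even S \<union> ?even T = V \<and> ?odd S \<union> ?odd T = W" for S T V W
    using join_sets_eq_iff[of "?even S \<union> ?even T" "?odd S \<union> ?odd T" V W]
    by (simp add: join_sets_Un[symmetric] del: join_sets_eq_iff)
  have "cover_sum F (disjoint_union G H) =
      (\<Sum>((S, T), (S', T'))\<in>{(S, T). S \<union> T = verts G} \<times> {(S, T). S \<union> T = verts H}.
         F (disjoint_union (induced_subgraph G S) (induced_subgraph H S'))
           (disjoint_union (induced_subgraph G T) (induced_subgraph H T')))"
    unfolding cover_sum_def
    by (rule sum.reindex_bij_witness[where j = "\<lambda>(S, T). ((?even S, ?even T), (?odd S, ?odd T))"
          and i = "\<lambda>((S, T), (S', T')). (join_sets S S', join_sets T T')"])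
      (auto simp: verts_disjoint_union_join Un join_sets_Un simp flip: induced_disjoint_union)
  then show ?thesis
    by (simp add: cover_sum_def sum.cartesian_product case_prod_unfold)
qed

section \<open>The Hopf algebra predual to graphs\<close>

lemma finite_class_factors: "finite {p. class_union (fst p) (snd p) = E}"
proof (rule finite_subset)
  show "{p. class_union (fst p) (snd p) = E} \<subseteq>
      {C. class_order C \<le> class_order E} \<times> {C. class_order C \<le> class_order E}"
    by (auto simp: class_order_union)
qed (simp add: finite_class_order_le)

lemma column_finite_class_union:
  "column_finite (\<lambda>(C, D). delta (class_union C D) :: _ \<Rightarrow> 'k::comm_ring_1)"
  unfolding column_finite_def
proof
  fix E
  show "finite {p. (case p of (C, D) \<Rightarrow> delta (class_union C D)) E \<noteq> (0 :: 'k)}"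
    by (rule finite_subset[OF _ finite_class_factors[of E]])
      (auto simp: delta_def split: if_splits)
qed

lemma sum_fun_apply: "sum f X x = (\<Sum>i\<in>X. f i x)"
  by (induction X rule: infinite_finite_induct) auto

lemma std_pair_sum_fun: "std_pair a (\<Sum>x\<in>X. \<phi> x) = (\<Sum>x\<in>X. std_pair a (\<phi> x))"
proof -
  have "sum \<phi> X = (\<lambda>i. \<Sum>x\<in>X. \<phi> x i)" by (simp add: fun_eq_iff sum_fun_apply)
  then show ?thesis by (simp add: std_pair_sum_right)
qed

lemma class_coproduct_iso_class:
  "class_coproduct (iso_class G) =
     (\<Sum>(S, T) | S \<union> T = verts G.
        delta (iso_class (induced_subgraph G S), iso_class (induced_subgraph G T)))"
  by (rule class_coproduct.abs_eq)

lemma std_pair_class_coproduct: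
  "std_pair t (class_coproduct (iso_class G)) =
     cover_sum (\<lambda>H K. Poly_Mapping.lookup t (iso_class H, iso_class K)) G"
  by (simp add: class_coproduct_iso_class std_pair_sum_fun cover_sum_def case_prod_unfold)

text \<open>
  A graph covered by induced subgraphs isomorphic to \<open>D\<close> and \<open>E\<close> has at most \<open>|D| + |E|\<close>
  vertices, and there are only finitely many isomorphism classes of such graphs.
\<close>

lemma column_finite_class_coproduct:
  "column_finite (class_coproduct :: _ \<Rightarrow> _ \<Rightarrow> 'k::comm_ring_1)"
  unfolding column_finite_def
proof
  fix q :: "graph_class \<times> graph_class"
  obtain D E where q: "q = (D, E)" by fastforce
  have "class_order C \<le> class_order D + class_order E" if nz: "class_coproduct C q \<noteq> (0 :: 'k)" for C
  proof (cases C rule: iso_class_cases)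
    case (1 G)
    have "class_coproduct C q = cover_sum (\<lambda>H K. Poly_Mapping.lookup (basis q :: _ \<Rightarrow>\<^sub>0 'k) (iso_class H, iso_class K)) G"
      using std_pair_class_coproduct[of "basis q :: _ \<Rightarrow>\<^sub>0 'k" G] by (simp add: 1)
    then obtain p where p: "p \<in> {(S, T). S \<union> T = verts G}"
      "(case p of (S, T) \<Rightarrow> Poly_Mapping.lookup (basis q :: _ \<Rightarrow>\<^sub>0 'k)
        (iso_class (induced_subgraph G S), iso_class (induced_subgraph G T))) \<noteq> 0"
      using nz unfolding cover_sum_def by (auto elim: sum.not_neutral_contains_not_neutral)
    obtain S T where ST: "S \<union> T = verts G" "D = iso_class (induced_subgraph G S)"
      "E = iso_class (induced_subgraph G T)"
      using p by (auto simp: lookup_single when_def q split: if_splits)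
    have "card (verts G) \<le> card S + card T"
      unfolding ST(1)[symmetric] by (rule card_Un_le)
    moreover have "S \<subseteq> verts G" "T \<subseteq> verts G"
      using ST(1) by auto
    ultimately show ?thesis
      by (simp add: 1 ST(2,3) verts_induced_subset)
  qed
  then show "finite {C. class_coproduct C q \<noteq> (0 :: 'k)}"
    by (intro finite_subset[OF _ finite_class_order_le]) blast
qed

text \<open>
  The structure maps of the predual are adjoint to the coproduct and the product of graphs, in
  this order.
\<close>

definition graph_mult :: "(graph_class \<times> graph_class \<Rightarrow>\<^sub>0 'k) \<Rightarrow> (graph_class \<Rightarrow>\<^sub>0 'k::comm_ring_1)" where
  "graph_mult = predual_map class_coproduct"

definition graph_comult :: "(graph_class \<Rightarrow>\<^sub>0 'k) \<Rightarrow> (graph_class \<times> graph_class \<Rightarrow>\<^sub>0 'k::comm_ring_1)" where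
  "graph_comult = predual_map (\<lambda>(C, D). delta (class_union C D))"

abbreviation empty_class :: graph_class where
  "empty_class \<equiv> iso_class empty_graph"

lemma lookup_graph_comult [simp]:
  "Poly_Mapping.lookup (graph_comult a) (C, D) = Poly_Mapping.lookup a (class_union C D)"
  by (simp add: graph_comult_def lookup_predual_map[OF column_finite_class_union])

lemma lookup_graph_mult: "Poly_Mapping.lookup (graph_mult t) C = std_pair t (class_coproduct C)"
  by (simp add: graph_mult_def lookup_predual_map[OF column_finite_class_coproduct])

lemma std_pair_graph_comult:
  "std_pair (graph_comult a) \<Phi> = std_pair a (\<lambda>E. \<Sum>p | class_union (fst p) (snd p) = E. \<Phi> p)"
proof -
  have "cont_ext (\<lambda>(C, D). delta (class_union C D)) \<Phi> E = (\<Sum>p | class_union (fst p) (snd p) = E. \<Phi> p)"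
    for E
    by (subst cont_ext_superset[OF finite_class_factors[of E]])
      (auto simp: delta_def split: if_splits intro!: sum.cong)
  then have "cont_ext (\<lambda>(C, D). delta (class_union C D)) \<Phi> =
      (\<lambda>E. \<Sum>p | class_union (fst p) (snd p) = E. \<Phi> p)"
    by (rule ext)
  then show ?thesis
    by (simp add: graph_comult_def std_pair_predual_map[OF column_finite_class_union])
qed

definition grouplike_value :: "(graph_class \<Rightarrow>\<^sub>0 'k) \<Rightarrow> sgraph \<Rightarrow> 'k::comm_ring_1" where
  "grouplike_value a = subset_sum (\<lambda>G. Poly_Mapping.lookup a (iso_class G))"

lemma grouplike_value_inject:
  assumes "\<And>G. grouplike_value a G = grouplike_value b G"
  shows "a = b"
proof (rule poly_mapping_eqI)
  fix C
  show "Poly_Mapping.lookup a C = Poly_Mapping.lookup b C"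
    using subset_sum_inject[OF assms[unfolded grouplike_value_def]]
    by (cases C rule: iso_class_cases) simp
qed

text \<open>
  Together with \<open>grouplike_value_inject\<close> this embeds the predual, as an algebra, into the functions
  on graphs with pointwise multiplication.
\<close>

lemma grouplike_value_mult:
  "grouplike_value (graph_mult (tensor a b)) G = grouplike_value a G * grouplike_value b G"
  by (simp add: grouplike_value_def lookup_graph_mult std_pair_class_coproduct subset_sum_cover)
    (simp add: subset_sum_def sum_product)

lemma iso_class_induced_eq_empty:
  "S \<subseteq> verts G \<Longrightarrow> iso_class (induced_subgraph G S) = empty_class \<longleftrightarrow> S = {}"
  by (simp add: verts_induced_subset finite_subset[OF _ finite_verts] flip: class_order_eq_0)

lemma grouplike_value_unit: "grouplike_value (basis empty_class) G = 1"
proof -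
  have "grouplike_value (basis empty_class :: _ \<Rightarrow>\<^sub>0 'a) G = (\<Sum>S\<in>Pow (verts G). if S = {} then 1 else 0)"
    unfolding grouplike_value_def subset_sum_def
    by (intro sum.cong) (auto simp: lookup_single when_def eq_commute[of empty_class] iso_class_induced_eq_empty)
  then show ?thesis by (simp add: finite_verts)
qed

lemma grouplike_value_empty: "grouplike_value a empty_graph = Poly_Mapping.lookup a empty_class"
  by (simp add: grouplike_value_def subset_sum_def induced_subgraph_whole)

lemma graph_mult_commute: "graph_mult (tensor a b) = graph_mult (tensor b a)"
  by (rule grouplike_value_inject) (simp add: grouplike_value_mult mult.commute)

lemma module_hom_graph_mult: "module_hom free_scale free_scale graph_mult"
  unfolding graph_mult_def by (intro module_hom_predual_map column_finite_class_coproduct)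

lemma algebra_graphs: "algebra_on_free graph_mult (basis empty_class :: _ \<Rightarrow>\<^sub>0 'k::comm_ring_1)"
  unfolding algebra_on_free_def
  by (intro conjI allI module_hom_graph_mult; rule grouplike_value_inject)
    (simp_all add: grouplike_value_mult grouplike_value_unit mult.assoc)

lemma lookup_lin_ext: "Poly_Mapping.lookup (lin_ext v a) j = std_pair a (\<lambda>i. Poly_Mapping.lookup (v i) j)"
  by (simp add: std_pair_lin_ext flip: std_pair_delta)

lemma lookup_tensor_assoc [simp]:
  fixes x :: "('i \<times> 'j) \<times> 'l \<Rightarrow>\<^sub>0 'k::comm_ring_1"
  shows "Poly_Mapping.lookup (tensor_assoc x) (i, (j, l)) = Poly_Mapping.lookup x ((i, j), l)"
proof -
  have "(\<lambda>y. Poly_Mapping.lookup (case y of ((i, j), l) \<Rightarrow> basis (i, (j, l))) (i, (j, l))) =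
      (delta ((i, j), l) :: _ \<Rightarrow> 'k)"
    by (auto simp: fun_eq_iff delta_def lookup_single when_def)
  then show ?thesis by (simp add: tensor_assoc_def lookup_lin_ext case_prod_unfold)
qed

lemma lookup_tensor_middle_swap [simp]:
  fixes x :: "('i \<times> 'j) \<times> ('p \<times> 'q) \<Rightarrow>\<^sub>0 'k::comm_ring_1"
  shows "Poly_Mapping.lookup (tensor_middle_swap x) ((i, p), (j, q)) = Poly_Mapping.lookup x ((i, j), (p, q))"
proof -
  have "(\<lambda>y. Poly_Mapping.lookup (case y of ((i, j), (p, q)) \<Rightarrow> basis ((i, p), (j, q))) ((i, p), (j, q))) =
      (delta ((i, j), (p, q)) :: _ \<Rightarrow> 'k)"
    by (auto simp: fun_eq_iff delta_def lookup_single when_def)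
  then show ?thesis by (simp add: tensor_middle_swap_def lookup_lin_ext case_prod_unfold)
qed

lemma lookup_basis: "Poly_Mapping.lookup (basis i) j = delta j i"
  by (auto simp: lookup_single when_def delta_def)

text \<open>
  The coproduct of the functional \<open>a\<close> is \<open>(C, D) \<mapsto> a (C \<squnion> D)\<close>, so coassociativity and the counit
  laws are the monoid laws for the disjoint union.
\<close>

lemma coalgebra_graphs:
  "coalgebra_on_free graph_comult (\<lambda>a. Poly_Mapping.lookup a empty_class :: 'k::comm_ring_1)"
  unfolding coalgebra_on_free_def
proof (intro conjI allI)
  show "module_hom free_scale free_scale (graph_comult :: (_ \<Rightarrow>\<^sub>0 'k) \<Rightarrow> _)"
    unfolding graph_comult_def by (intro module_hom_predual_map column_finite_class_union)
  show "module_hom free_scale (*) (\<lambda>a. Poly_Mapping.lookup a empty_class :: 'k)"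
    using module_hom_pair[of "delta empty_class"] by simp
next
  fix a :: "graph_class \<Rightarrow>\<^sub>0 'k"
  have 1: "(\<lambda>(i, j). delta (class_union p q) i * delta l j :: 'k) = delta (class_union p q, l)" for p q l
    by (auto simp: fun_eq_iff delta_def)
  have 2: "(\<lambda>(i, j). delta p i * delta (class_union q l) j :: 'k) = delta (p, class_union q l)" for p q l
    by (auto simp: fun_eq_iff delta_def)
  show "tensor_assoc (tensor_map graph_comult id (graph_comult a)) =
      tensor_map id graph_comult (graph_comult a)"
  proof (rule poly_mapping_eqI)
    fix x :: "graph_class \<times> graph_class \<times> graph_class"
    obtain p q l where "x = (p, q, l)" by (metis surj_pair)
    then show "Poly_Mapping.lookup (tensor_assoc (tensor_map graph_comult id (graph_comult a))) x =
        Poly_Mapping.lookup (tensor_map id graph_comult (graph_comult a)) x"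
      by (simp add: lookup_tensor_map lookup_basis 1 2 class_union_assoc)
  qed
  have 3: "(\<lambda>x. Poly_Mapping.lookup (basis (fst x)) empty_class * Poly_Mapping.lookup (basis (snd x)) C) =
      (delta (empty_class, C) :: _ \<Rightarrow> 'k)" for C :: graph_class
    by (auto simp: fun_eq_iff lookup_basis delta_def)
  show "lin_ext (\<lambda>(i, j). free_scale (Poly_Mapping.lookup (basis i) empty_class) (basis j)) (graph_comult a) = a"
    by (rule poly_mapping_eqI) (simp add: lookup_lin_ext case_prod_unfold 3)
  have 4: "(\<lambda>x. Poly_Mapping.lookup (basis (snd x)) empty_class * Poly_Mapping.lookup (basis (fst x)) C) =
      (delta (C, empty_class) :: _ \<Rightarrow> 'k)" for C :: graph_class
    by (auto simp: fun_eq_iff lookup_basis delta_def)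
  show "lin_ext (\<lambda>(i, j). free_scale (Poly_Mapping.lookup (basis j) empty_class) (basis i)) (graph_comult a) = a"
    by (rule poly_mapping_eqI) (simp add: lookup_lin_ext case_prod_unfold 4)
qed

lemma std_pair_class_coproduct_product:
  "std_pair t (\<lambda>(x, y). class_coproduct (iso_class G) x * class_coproduct (iso_class H) y) =
     cover_sum (\<lambda>G' G''. cover_sum (\<lambda>H' H''.
       Poly_Mapping.lookup t ((iso_class G', iso_class G''), (iso_class H', iso_class H''))) H) G"
proof -
  let ?g = "\<lambda>p. (iso_class (induced_subgraph G (fst p)), iso_class (induced_subgraph G (snd p)))"
  let ?h = "\<lambda>p. (iso_class (induced_subgraph H (fst p)), iso_class (induced_subgraph H (snd p)))"
  let ?X = "{(S, T). S \<union> T = verts G}" and ?Y = "{(S, T). S \<union> T = verts H}"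
  have "(\<lambda>(x, y). class_coproduct (iso_class G) x * class_coproduct (iso_class H) y) =
      (\<Sum>p\<in>?X. \<Sum>q\<in>?Y. delta (?g p, ?h q) :: _ \<Rightarrow> 'a)"
    by (auto simp: fun_eq_iff class_coproduct_iso_class sum_fun_apply sum_product case_prod_unfold
        delta_def intro!: sum.cong)
  then show ?thesis
    by (simp add: std_pair_sum_fun cover_sum_def case_prod_unfold)
qed

lemma bialgebra_graphs:
  "bialgebra_on_free graph_mult (basis empty_class) graph_comult
     (\<lambda>a. Poly_Mapping.lookup a empty_class :: 'k::comm_ring_1)"
  unfolding bialgebra_on_free_def
proof (intro conjI allI algebra_graphs coalgebra_graphs)
  show "graph_comult (basis empty_class) = tensor (basis empty_class) (basis empty_class :: _ \<Rightarrow>\<^sub>0 'k)"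
  proof (rule poly_mapping_eqI)
    fix x :: "graph_class \<times> graph_class"
    obtain C D where "x = (C, D)" by fastforce
    moreover have "class_union C D = empty_class \<longleftrightarrow> C = empty_class \<and> D = empty_class"
      by (simp add: class_order_union flip: class_order_eq_0)
    ultimately show "Poly_Mapping.lookup (graph_comult (basis empty_class)) x =
        Poly_Mapping.lookup (tensor (basis empty_class) (basis empty_class :: _ \<Rightarrow>\<^sub>0 'k)) x"
      by (simp add: lookup_basis delta_def eq_commute[of empty_class])
  qed
next
  fix a b :: "graph_class \<Rightarrow>\<^sub>0 'k"
  show "Poly_Mapping.lookup (graph_mult (tensor a b)) empty_class =
      Poly_Mapping.lookup a empty_class * Poly_Mapping.lookup b empty_class"
    by (simp add: grouplike_value_mult flip: grouplike_value_empty)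
  show "graph_comult (graph_mult (tensor a b)) =
      tensor_map graph_mult graph_mult (tensor_middle_swap (tensor (graph_comult a) (graph_comult b)))"
  proof (rule poly_mapping_eqI)
    fix x :: "graph_class \<times> graph_class"
    obtain G H where "x = (iso_class G, iso_class H)"
      by (metis surj_pair iso_class_cases)
    moreover have "Poly_Mapping.lookup (tensor_map graph_mult graph_mult t) (iso_class G, iso_class H) =
        cover_sum (\<lambda>G' G''. cover_sum (\<lambda>H' H''.
          Poly_Mapping.lookup t ((iso_class G', iso_class G''), (iso_class H', iso_class H''))) H) G"
      for t :: "_ \<Rightarrow>\<^sub>0 'k"
      by (simp add: lookup_tensor_map lookup_graph_mult std_pair_class_coproduct_product)
    ultimately show "Poly_Mapping.lookup (graph_comult (graph_mult (tensor a b))) x =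
        Poly_Mapping.lookup (tensor_map graph_mult graph_mult
          (tensor_middle_swap (tensor (graph_comult a) (graph_comult b)))) x"
      by (simp add: lookup_graph_mult std_pair_class_coproduct cover_sum_disjoint_union)
  qed
qed simp

lemma lookup_convolution:
  "Poly_Mapping.lookup (graph_mult (tensor_map f g (graph_comult a))) C =
     std_pair a (\<lambda>E. Poly_Mapping.lookup
       (\<Sum>p | class_union (fst p) (snd p) = E. graph_mult (tensor (f (basis (fst p))) (g (basis (snd p))))) C)"
  by (simp add: lookup_graph_mult std_pair_tensor_map std_pair_graph_comult lookup_sum
      std_pair_tensor case_prod_unfold)

text \<open>
  The convolution identity \<open>(\<Sum>C = D \<squnion> E. S(D) E) = \<epsilon>(C) 1\<close>, in which \<open>E\<close> empty gives the
  summand \<open>S(C)\<close>, solved for \<open>S(C)\<close>; in the other summands \<open>D\<close> has fewer vertices than \<open>C\<close>.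
\<close>

function antipode_value :: "graph_class \<Rightarrow> (graph_class \<Rightarrow>\<^sub>0 'k::comm_ring_1)" where
  "antipode_value C =
     (if C = empty_class then basis empty_class
      else - (\<Sum>p | class_union (fst p) (snd p) = C \<and> snd p \<noteq> empty_class.
                graph_mult (tensor (antipode_value (fst p)) (basis (snd p)))))"
  by pat_completeness auto
termination
  by (relation "measure class_order")
    (auto simp: class_order_union simp flip: class_order_eq_0)

declare antipode_value.simps [simp del]

lemma antipode_value_sum:
  "(\<Sum>p | class_union (fst p) (snd p) = C. graph_mult (tensor (antipode_value (fst p)) (basis (snd p)))) =
     (if C = empty_class then basis empty_class else 0 :: _ \<Rightarrow>\<^sub>0 'k::comm_ring_1)"
proof -
  let ?f = "\<lambda>p. graph_mult (tensor (antipode_value (fst p)) (basis (snd p))) :: _ \<Rightarrow>\<^sub>0 'k"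
  let ?P = "{p. class_union (fst p) (snd p) = C}"
  have "?f (C, empty_class) = antipode_value C"
    by (rule grouplike_value_inject) (simp add: grouplike_value_mult grouplike_value_unit)
  then have "sum ?f ?P = antipode_value C + sum ?f (?P - {(C, empty_class)})"
    by (subst sum.remove[OF finite_class_factors, of "(C, empty_class)"]) auto
  also have "?P - {(C, empty_class)} = {p. class_union (fst p) (snd p) = C \<and> snd p \<noteq> empty_class}"
    by auto
  also have "antipode_value C + sum ?f \<dots> = (if C = empty_class then basis empty_class else 0)"
  proof (cases "C = empty_class")
    case True
    have empty: "{p. class_union (fst p) (snd p) = C \<and> snd p \<noteq> empty_class} = {}"
      by (auto simp: True class_order_union simp flip: class_order_eq_0)
    have "antipode_value C = (basis empty_class :: _ \<Rightarrow>\<^sub>0 'k)"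
      by (subst antipode_value.simps) (simp add: True)
    then show ?thesis
      by (simp only: empty sum.empty) (simp add: True)
  next
    case False
    then show ?thesis by (subst antipode_value.simps) simp
  qed
  finally show ?thesis .
qed

lemma hopf_algebra_graphs:
  "hopf_algebra_on_free graph_mult (basis empty_class) graph_comult
     (\<lambda>a. Poly_Mapping.lookup a empty_class :: 'k::comm_ring_1)"
  unfolding hopf_algebra_on_free_def
proof (intro conjI exI[of _ "lin_ext antipode_value"] allI bialgebra_graphs)
  let ?S = "lin_ext antipode_value :: _ \<Rightarrow> (graph_class \<Rightarrow>\<^sub>0 'k)"
  have S: "?S (basis C) = antipode_value C" for C
    by (rule poly_mapping_eqI) (simp add: lookup_lin_ext)
  show "module_hom free_scale free_scale ?S"
    by (rule module_homI_pair) (rule std_pair_lin_ext)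
  fix a :: "graph_class \<Rightarrow>\<^sub>0 'k"
  have counit: "std_pair a (\<lambda>E. Poly_Mapping.lookup (if E = empty_class then basis empty_class else 0) C) =
      Poly_Mapping.lookup (free_scale (Poly_Mapping.lookup a empty_class) (basis empty_class)) C" for C
  proof -
    have "(\<lambda>E. Poly_Mapping.lookup (if E = empty_class then basis empty_class else 0) C) =
        (\<lambda>E. delta empty_class E * Poly_Mapping.lookup (basis empty_class :: _ \<Rightarrow>\<^sub>0 'k) C)"
      by (auto simp: delta_def)
    then show ?thesis by (simp add: std_pair_scale_right')
  qed
  show left: "graph_mult (tensor_map ?S id (graph_comult a)) =
      free_scale (Poly_Mapping.lookup a empty_class) (basis empty_class)"
    by (rule poly_mapping_eqI)
      (simp add: lookup_convolution S antipode_value_sum counit del: lookup_free_scale)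
  \<comment> \<open>Commutativity of product and coproduct turns the left inverse into a right inverse.\<close>
  have "(\<Sum>p | class_union (fst p) (snd p) = E. graph_mult (tensor (basis (fst p)) (antipode_value (snd p)))) =
        (\<Sum>p | class_union (fst p) (snd p) = E. graph_mult (tensor (antipode_value (fst p)) (basis (snd p) :: _ \<Rightarrow>\<^sub>0 'k)))"
    for E
    by (rule sum.reindex_bij_witness[where i = prod.swap and j = prod.swap])
      (auto simp: class_union_commute graph_mult_commute)
  then show "graph_mult (tensor_map id ?S (graph_comult a)) =
      free_scale (Poly_Mapping.lookup a empty_class) (basis empty_class)"
    by (intro poly_mapping_eqI)
      (simp add: lookup_convolution S antipode_value_sum counit del: lookup_free_scale)
qed

section \<open>Graphs form an LC-Hopf algebra\<close>

text \<open>
  A functional on a free module is given by arbitrary values on the basis.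
\<close>

lemma is_lc_module_functions:
  assumes "lc_carrier B = UNIV" "lc_scale B = (\<lambda>c f i. c * f i)" "lc_pair B = std_pair"
  shows "is_lc_module (B :: ('i, 'i \<Rightarrow> 'k::idom, 'k, 'z) lc_module_scheme)"
proof -
  have mod: "module (\<lambda>c (f :: 'i \<Rightarrow> 'k) i. c * f i)"
    by unfold_locales (auto simp: fun_eq_iff algebra_simps)
  have "bij_betw (\<lambda>b a. std_pair a b) (UNIV :: ('i \<Rightarrow> 'k) set) {\<phi>. module_hom free_scale (*) \<phi>}"
    unfolding bij_betw_def
  proof (intro conjI equalityI subsetI injI)
    fix \<phi> \<psi> :: "'i \<Rightarrow> 'k"
    assume "(\<lambda>a. std_pair a \<phi>) = (\<lambda>a. std_pair a \<psi>)"
    then have "std_pair (basis i) \<phi> = std_pair (basis i) \<psi>" for i by (rule fun_cong)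
    then show "\<phi> = \<psi>" by (simp add: fun_eq_iff)
  next
    fix F :: "('i \<Rightarrow>\<^sub>0 'k) \<Rightarrow> 'k"
    assume "F \<in> {\<phi>. module_hom free_scale (*) \<phi>}"
    then have "F = (\<lambda>a. std_pair a (\<lambda>i. F (basis i)))"
      using module_hom_eq_pair by fast
    then show "F \<in> range (\<lambda>b a. std_pair a b)" by blast
  qed (auto simp: module_hom_pair)
  then show ?thesis
    unfolding is_lc_module_def assms
    using mod module.subspace_UNIV[OF mod]
    by (auto simp: linear_on_carrier_def plus_fun_def std_pair_add_right std_pair_scale_right)
qed

lemma lc_hopf_algebra_mGraphs:
  "lc_hopf_algebra (mGraphs :: (graph_class, graph_class \<Rightarrow> 'k, 'k::idom) lc_bialgebra)"
proof -
  have counit: "cont_ext (\<lambda>C _. 0 ^ class_order C) b () = b empty_class" for b :: "graph_class \<Rightarrow> 'k"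
    by (subst cont_ext_superset[of "{empty_class}"])
      (auto simp: zero_power_eq split: if_splits)
  show ?thesis
    unfolding lc_hopf_algebra_def
  proof (intro conjI exI[of _ graph_mult] exI[of _ "basis empty_class"] exI[of _ graph_comult]
      exI[of _ "\<lambda>a. Poly_Mapping.lookup a empty_class"] allI ballI hopf_algebra_graphs)
    show "is_lc_module (mGraphs :: (graph_class, graph_class \<Rightarrow> 'k, 'k) lc_bialgebra)"
      by (rule is_lc_module_functions) (simp_all add: mGraphs_def)
  qed (simp_all add: mGraphs_def graph_mult_def graph_comult_def counit
      std_pair_predual_map column_finite_class_union column_finite_class_coproduct)
qed

section \<open>Kromatic symmetric functions through stable sets\<close>

definition stable_sets :: "sgraph \<Rightarrow> nat \<Rightarrow> nat set set" where
  "stable_sets G n = {S. S \<subseteq> verts G \<and> card S = n \<and> (\<forall>e\<in>edges G. \<not> e \<subseteq> S)}"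

text \<open>
  The coefficient of \<open>t\<^sup>n\<close> in the polynomial \<open>p\<^sub>G(t) = \<Sum>T stable. t\<^sup>|T|\<close>.
\<close>

definition stable_count :: "sgraph \<Rightarrow> nat \<Rightarrow> 'a::comm_ring_1" where
  "stable_count G n = of_nat (card (stable_sets G n))"

lemma finite_stable_sets: "finite (stable_sets G n)"
  by (rule finite_subset[of _ "Pow (verts G)"]) (auto simp: stable_sets_def finite_verts)

lemma edge_cases:
  assumes "e \<in> edges G"
  obtains u v where "e = {u, v}" "u \<in> verts G" "v \<in> verts G"
proof -
  have "card e = 2"
    using assms Rep_sgraph[of G] by (auto simp: edges.rep_eq case_prod_unfold)
  then obtain u v where "e = {u, v}" by (auto simp: card_2_iff)
  then show thesis using that edges_subset_verts[OF assms] by auto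
qed

lemma lookup_coloring_monomial:
  assumes "\<kappa> \<in> proper_set_colorings G"
  shows "Poly_Mapping.lookup (coloring_monomial G \<kappa>) i = card {v \<in> verts G. i \<in> \<kappa> v}"
proof -
  have "(\<Sum>j\<in>\<kappa> v. Poly_Mapping.lookup (Poly_Mapping.single j 1) i) = (if i \<in> \<kappa> v then 1 else 0 :: nat)"
    if "v \<in> verts G" for v
  proof -
    have "finite (\<kappa> v)" using assms that by (auto simp: proper_set_colorings_def PiE_def Pi_def)
    then show ?thesis by (simp add: lookup_single when_def)
  qed
  then show ?thesis
    by (simp add: coloring_monomial_def lookup_sum finite_verts)
      (simp add: finite_verts flip: sum.inter_filter)
qed

text \<open>
  A coloring is described here by its color classes \<open>{v. i \<in> \<kappa> v}\<close>: the exponents of its monomial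
  are their sizes, and it is proper iff they are stable.
\<close>

lemma mem_colorings_iff:
  "\<kappa> \<in> proper_set_colorings G \<and> coloring_monomial G \<kappa> = x \<longleftrightarrow>
     \<kappa> \<in> verts G \<rightarrow>\<^sub>E {S. finite S \<and> S \<noteq> {}} \<and>
     (\<forall>i. card {v \<in> verts G. i \<in> \<kappa> v} = Poly_Mapping.lookup x i \<and>
          (\<forall>e\<in>edges G. \<not> e \<subseteq> {v \<in> verts G. i \<in> \<kappa> v}))"
proof -
  have "(\<forall>u v. {u, v} \<in> edges G \<longrightarrow> \<kappa> u \<inter> \<kappa> v = {}) \<longleftrightarrow>
      (\<forall>i. \<forall>e\<in>edges G. \<not> e \<subseteq> {v \<in> verts G. i \<in> \<kappa> v})" (is "?L \<longleftrightarrow> ?R")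
  proof
    assume L: ?L
    show ?R
    proof (intro allI ballI notI)
      fix i e assume e: "e \<in> edges G" "e \<subseteq> {v \<in> verts G. i \<in> \<kappa> v}"
      obtain u v where "e = {u, v}" using e(1) by (rule edge_cases)
      then show False using L e by auto
    qed
  next
    assume R: ?R
    show ?L
    proof (intro allI impI equals0I)
      fix u v i assume "{u, v} \<in> edges G" "i \<in> \<kappa> u \<inter> \<kappa> v"
      then show False
        using R[rule_format, of "{u, v}" i] edges_subset_verts[of "{u, v}" G] by auto
    qed
  qed
  moreover have "coloring_monomial G \<kappa> = x \<longleftrightarrow>
      (\<forall>i. card {v \<in> verts G. i \<in> \<kappa> v} = Poly_Mapping.lookup x i)"
    if "\<kappa> \<in> proper_set_colorings G"
    by (simp add: poly_mapping_eq_iff fun_eq_iff lookup_coloring_monomial[OF that])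
  moreover from calculation(1)
  have proper: "\<kappa> \<in> proper_set_colorings G \<longleftrightarrow> \<kappa> \<in> verts G \<rightarrow>\<^sub>E {S. finite S \<and> S \<noteq> {}} \<and>
      (\<forall>i. \<forall>e\<in>edges G. \<not> e \<subseteq> {v \<in> verts G. i \<in> \<kappa> v})"
    unfolding proper_set_colorings_def by simp
  ultimately show ?thesis
    unfolding all_conj_distrib by argo
qed

text \<open>
  Summing over all induced subgraphs amounts to admitting the empty set as a set of colors. A
  coloring is then nothing but an independent choice, for each color, of the stable set of
  vertices using it.
\<close>

lemma bij_betw_colorings_stable_sets:
  assumes "finite I" "Poly_Mapping.keys x \<subseteq> I"
  shows "bij_betw (\<lambda>(S, \<kappa>). \<lambda>i\<in>I. {v \<in> S. i \<in> \<kappa> v})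
    (SIGMA S:Pow (verts G). {\<kappa> \<in> proper_set_colorings (induced_subgraph G S).
        coloring_monomial (induced_subgraph G S) \<kappa> = x})
    (PiE I (\<lambda>i. stable_sets G (Poly_Mapping.lookup x i)))"
    (is "bij_betw ?j ?C ?P")
proof -
  let ?U = "\<lambda>T :: nat \<Rightarrow> nat set. \<Union>i\<in>I. T i"
  let ?i = "\<lambda>T. (?U T, \<lambda>v\<in>?U T. {i \<in> I. v \<in> T i})"
  have memC: "(S, \<kappa>) \<in> ?C \<longleftrightarrow> S \<subseteq> verts G \<and> \<kappa> \<in> S \<rightarrow>\<^sub>E {S. finite S \<and> S \<noteq> {}} \<and>
     (\<forall>i. card {v \<in> S. i \<in> \<kappa> v} = Poly_Mapping.lookup x i \<and>
          (\<forall>e\<in>edges G. \<not> e \<subseteq> {v \<in> S. i \<in> \<kappa> v}))" for S \<kappa>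
  proof (cases "S \<subseteq> verts G")
    case True
    have "(\<forall>e\<in>edges (induced_subgraph G S). \<not> e \<subseteq> {v \<in> S. i \<in> \<kappa> v}) \<longleftrightarrow>
        (\<forall>e\<in>edges G. \<not> e \<subseteq> {v \<in> S. i \<in> \<kappa> v})" for i
      by (auto simp: edges_induced_subgraph)
    then show ?thesis
      using True by (simp add: mem_colorings_iff verts_induced_subset)
  qed simp
  have memP: "T \<in> ?P \<longleftrightarrow> T \<in> extensional I \<and> (\<forall>i\<in>I. T i \<subseteq> verts G \<and>
      card (T i) = Poly_Mapping.lookup x i \<and> (\<forall>e\<in>edges G. \<not> e \<subseteq> T i))" for T
    by (auto simp: PiE_iff stable_sets_def)
  have colors: "\<kappa> v \<subseteq> I" if "(S, \<kappa>) \<in> ?C" "v \<in> S" for S \<kappa> v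
  proof
    fix i assume "i \<in> \<kappa> v"
    then have "{v \<in> S. i \<in> \<kappa> v} \<noteq> {}" using that(2) by blast
    moreover have "finite {v \<in> S. i \<in> \<kappa> v}"
      using that(1) unfolding memC by (auto intro: finite_subset[OF _ finite_verts[of G]])
    ultimately have "Poly_Mapping.lookup x i \<noteq> 0"
      using that(1) unfolding memC by (metis card_0_eq)
    then show "i \<in> I" using assms(2) by (auto simp: in_keys_iff)
  qed
  show ?thesis
  proof (rule bij_betw_byWitness[where f' = ?i])
    show "\<forall>p\<in>?C. ?i (?j p) = p"
    proof
      fix p assume p: "p \<in> ?C"
      obtain S \<kappa> where p_eq: "p = (S, \<kappa>)" by fastforce
      have mem: "(S, \<kappa>) \<in> ?C" using p by (simp only: p_eq)
      have PiE: "\<kappa> \<in> S \<rightarrow>\<^sub>E {S. finite S \<and> S \<noteq> {}}" using mem[unfolded memC] by (elim conjE)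
      have \<kappa>: "\<kappa> v \<noteq> {}" "\<kappa> v \<subseteq> I" if "v \<in> S" for v
        using PiE_mem[OF PiE that] colors[OF mem that] by simp_all
      have ext: "\<kappa> \<in> extensional S" using PiE by (simp add: PiE_iff)
      have "?U (\<lambda>i\<in>I. {v \<in> S. i \<in> \<kappa> v}) = S"
      proof (intro equalityI subsetI)
        fix v assume v: "v \<in> S"
        then obtain i where "i \<in> \<kappa> v" using \<kappa>(1) by blast
        then show "v \<in> ?U (\<lambda>i\<in>I. {v \<in> S. i \<in> \<kappa> v})" using v \<kappa>(2) by auto
      qed auto
      moreover have "(\<lambda>v\<in>S. {i \<in> I. v \<in> (\<lambda>i\<in>I. {v \<in> S. i \<in> \<kappa> v}) i}) = \<kappa>"
        using \<kappa>(2) ext by (auto simp: fun_eq_iff extensional_def)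
      ultimately show "?i (?j p) = p" by (simp only: p_eq prod.case)
    qed
    show "\<forall>T\<in>?P. ?j (?i T) = T"
      unfolding memP by (auto simp: fun_eq_iff extensional_def)
    show "?j ` ?C \<subseteq> ?P"
    proof (rule image_subsetI)
      fix p assume p: "p \<in> ?C"
      obtain S \<kappa> where "p = (S, \<kappa>)" by fastforce
      moreover from this have "(S, \<kappa>) \<in> ?C" using p by (simp only:)
      note this[unfolded memC]
      ultimately show "?j p \<in> ?P" unfolding memP by auto
    qed
    show "?i ` ?P \<subseteq> ?C"
    proof (rule image_subsetI)
      fix T assume T: "T \<in> ?P"
      have "{v \<in> ?U T. i \<in> (\<lambda>v\<in>?U T. {i \<in> I. v \<in> T i}) v} = (if i \<in> I then T i else {})" for i
        by auto
      moreover have "card (if i \<in> I then T i else {}) = Poly_Mapping.lookup x i" for i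
        using T assms(2) unfolding memP by (auto simp: in_keys_iff)
      moreover have "\<not> e \<subseteq> (if i \<in> I then T i else {})" if "e \<in> edges G" for e i
        using T edge_nonempty[OF that] that unfolding memP by auto
      ultimately show "?i T \<in> ?C"
        using T assms(1) unfolding memC memP by (simp add: PiE_iff) blast
    qed
  qed
qed

text \<open>
  The coefficient of \<open>x\<close> in the product \<open>\<Prod>i. p\<^sub>G(x\<^sub>i)\<close>. Since \<open>p\<^sub>G\<close> has constant coefficient 1, the
  set \<open>I\<close> of variables may be larger than the set of those that occur in \<open>x\<close>, which allows
  different monomials to be compared over the same set of variables.
\<close>

lemma subset_sum_kromatic:
  assumes "finite I" "Poly_Mapping.keys x \<subseteq> I"
  shows "subset_sum (\<lambda>H. kromatic H x) G =
    (\<Prod>i\<in>I. stable_count G (Poly_Mapping.lookup x i) :: 'a::comm_ring_1)"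
proof -
  let ?K = "\<lambda>S. {\<kappa> \<in> proper_set_colorings (induced_subgraph G S).
        coloring_monomial (induced_subgraph G S) \<kappa> = x}"
  note bij = bij_betw_colorings_stable_sets[OF assms, of G]
  have "finite (PiE I (\<lambda>i. stable_sets G (Poly_Mapping.lookup x i)))"
    by (intro finite_PiE assms(1) finite_stable_sets)
  then have fin: "finite (SIGMA S:Pow (verts G). ?K S)"
    using bij_betw_finite[OF bij] by blast
  have "finite (?K S)" if "S \<in> Pow (verts G)" for S
  proof (rule finite_subset[OF _ finite_imageI[OF fin, of snd]])
    show "?K S \<subseteq> snd ` (SIGMA S:Pow (verts G). ?K S)"
    proof
      fix \<kappa> assume "\<kappa> \<in> ?K S"
      with that have "(S, \<kappa>) \<in> (SIGMA S:Pow (verts G). ?K S)" by (rule SigmaI)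
      then show "\<kappa> \<in> snd ` (SIGMA S:Pow (verts G). ?K S)" by (rule image_eqI[rotated]) simp
    qed
  qed
  then have "(\<Sum>S\<in>Pow (verts G). card (?K S)) = card (SIGMA S:Pow (verts G). ?K S)"
    by (intro card_SigmaI[symmetric]) (auto simp: finite_verts)
  also have "\<dots> = (\<Prod>i\<in>I. card (stable_sets G (Poly_Mapping.lookup x i)))"
    using bij_betw_same_card[OF bij] card_PiE[OF assms(1)] by metis
  finally show ?thesis
    unfolding subset_sum_def kromatic_def stable_count_def
    by (simp flip: of_nat_sum of_nat_prod)
qed

lemma stable_count_subset_sum:
  "stable_count G n = subset_sum (\<lambda>H. if edges H = {} \<and> card (verts H) = n then 1 else 0) G"
proof -
  have "subset_sum (\<lambda>H. if edges H = {} \<and> card (verts H) = n then 1 else 0 :: 'a) G =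
      (\<Sum>S\<in>Pow (verts G). if S \<in> stable_sets G n then 1 else 0)"
    unfolding subset_sum_def
    by (intro sum.cong) (auto simp: stable_sets_def verts_induced_subset edges_induced_subgraph)
  also have "\<dots> = (\<Sum>S\<in>stable_sets G n. 1)"
    by (rule sum.mono_neutral_cong_right) (auto simp: finite_verts stable_sets_def)
  finally show ?thesis by (simp add: stable_count_def)
qed

lemma subset_sum_iso_invariant:
  assumes F: "\<And>G H. iso_class G = iso_class H \<Longrightarrow> F G = F H" and "iso_class G = iso_class H"
  shows "subset_sum F G = subset_sum F H"
proof -
  obtain f where f: "bij_betw f (verts G) (verts H)" "edges H = (`) f ` edges G"
    using assms(2) unfolding graph_class.abs_eq_iff graph_iso_def by blast
  have "F (induced_subgraph G S) = F (induced_subgraph H (f ` S))" if "S \<in> Pow (verts G)" for S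
    using that iso_class_induced_image[OF f, of S] by (intro F) simp
  then show ?thesis
    unfolding subset_sum_def
    using sum.reindex_bij_betw[OF bij_betw_Pow[OF f(1)], of "\<lambda>S. F (induced_subgraph H S)"] by simp
qed

lemma edges_empty_iff_class_size: "edges G = {} \<longleftrightarrow> class_size (iso_class G) = 0"
  by (simp add: finite_edges)

lemma stable_count_iso_invariant:
  "iso_class G = iso_class H \<Longrightarrow> stable_count G n = stable_count H n"
  unfolding stable_count_subset_sum
  by (erule subset_sum_iso_invariant[rotated])
    (simp add: edges_empty_iff_class_size del: class_size_iso_class class_order_iso_class
      flip: class_order_iso_class)

lemma kromatic_iso_invariant:
  assumes "iso_class G = iso_class H"
  shows "kromatic G = (kromatic H :: 'a::comm_ring_1 series)"
proof
  fix x
  show "kromatic G x = (kromatic H x :: 'a)"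
  proof (rule iso_invariant_subset_sum[OF _ assms])
    fix G H assume "iso_class G = iso_class H"
    then have "stable_count G n = (stable_count H n :: 'a)" for n
      by (rule stable_count_iso_invariant)
    then show "subset_sum (\<lambda>G. kromatic G x) G = (subset_sum (\<lambda>G. kromatic G x) H :: 'a)"
      by (simp only: subset_sum_kromatic[OF finite_keys order_refl])
  qed
qed

lemma stable_count_0 [simp]: "stable_count G 0 = 1"
proof -
  have "stable_sets G 0 = {{}}"
    using edge_nonempty by (auto simp: stable_sets_def finite_subset[OF _ finite_verts])
  then show ?thesis by (simp add: stable_count_def)
qed

text \<open>
  With only one color available, a proper coloring exists only if there are no edges, and then it
  is unique.
\<close>

lemma kromatic_single:
  "kromatic G (Poly_Mapping.single i n) =
     (if edges G = {} \<and> card (verts G) = n then 1 else 0 :: 'a::comm_ring_1)"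
proof (rule subset_sum_inject)
  fix G
  show "subset_sum (\<lambda>G. kromatic G (Poly_Mapping.single i n)) G =
      subset_sum (\<lambda>G. if edges G = {} \<and> card (verts G) = n then 1 else 0 :: 'a) G"
    by (subst subset_sum_kromatic[of "{i}"]) (auto simp: stable_count_subset_sum)
qed

lemma kromatic_empty_graph: "kromatic empty_graph x = (if x = 0 then 1 else 0)"
proof -
  have count: "stable_count empty_graph n = (if n = 0 then 1 else 0)" for n
    by (simp add: stable_count_subset_sum subset_sum_def induced_subgraph_whole)
  have "kromatic empty_graph x = subset_sum (\<lambda>H. kromatic H x :: 'a) empty_graph"
    by (simp add: subset_sum_def induced_subgraph_whole)
  \<comment> \<open>The only stable set is empty, but the exponents of the variables in \<open>x\<close> are positive.\<close>
  also have "\<dots> = (\<Prod>i\<in>Poly_Mapping.keys x. 0)"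
    by (subst subset_sum_kromatic[OF finite_keys order_refl])
      (auto simp: count in_keys_iff intro!: prod.cong)
  also have "\<dots> = (if x = 0 then 1 else 0)"
    by (simp add: power_0_left)
  finally show ?thesis .
qed

lemma kromatic_nonzero_card_verts:
  assumes "kromatic G x \<noteq> 0"
  shows "card (verts G) \<le> (\<Sum>i\<in>Poly_Mapping.keys x. Poly_Mapping.lookup x i)"
proof -
  have "{\<kappa> \<in> proper_set_colorings G. coloring_monomial G \<kappa> = x} \<noteq> {}"
    using assms unfolding kromatic_def by (metis card.empty of_nat_0)
  then obtain \<kappa> where "\<kappa> \<in> proper_set_colorings G \<and> coloring_monomial G \<kappa> = x" by blast
  then have PiE: "\<kappa> \<in> verts G \<rightarrow>\<^sub>E {S. finite S \<and> S \<noteq> {}}"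
    and count: "\<And>i. card {v \<in> verts G. i \<in> \<kappa> v} = Poly_Mapping.lookup x i"
    by (simp_all add: mem_colorings_iff)
  have \<kappa>: "\<kappa> v \<noteq> {}" if "v \<in> verts G" for v
    using PiE_mem[OF PiE that] by simp
  have "verts G \<subseteq> (\<Union>i\<in>Poly_Mapping.keys x. {v \<in> verts G. i \<in> \<kappa> v})"
  proof
    fix v assume v: "v \<in> verts G"
    then obtain i where i: "i \<in> \<kappa> v" using \<kappa> by blast
    then have "card {v \<in> verts G. i \<in> \<kappa> v} \<noteq> 0"
      using v finite_verts[of G] by auto
    then have "i \<in> Poly_Mapping.keys x" by (simp add: count in_keys_iff)
    then show "v \<in> (\<Union>i\<in>Poly_Mapping.keys x. {v \<in> verts G. i \<in> \<kappa> v})" using v i by blast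
  qed
  then have "card (verts G) \<le> card (\<Union>i\<in>Poly_Mapping.keys x. {v \<in> verts G. i \<in> \<kappa> v})"
    by (intro card_mono) (auto simp: finite_verts)
  also have "\<dots> \<le> (\<Sum>i\<in>Poly_Mapping.keys x. card {v \<in> verts G. i \<in> \<kappa> v})"
    by (rule card_UN_le) simp
  finally show ?thesis by (simp add: count)
qed

text \<open>
  The factors of \<open>\<Prod>i. p\<^sub>G(x\<^sub>i)\<close> for the variables of \<open>x\<close> and of \<open>y\<close> are independent. This becomes
  the compatibility of the kromatic functions with coproducts.
\<close>

lemma kromatic_add_disjoint:
  assumes "Poly_Mapping.keys x \<inter> Poly_Mapping.keys y = {}"
  shows "kromatic G (x + y) = cover_sum (\<lambda>H K. kromatic H x * kromatic K y :: 'a::comm_ring_1) G"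
proof (rule subset_sum_inject)
  fix G
  let ?I = "Poly_Mapping.keys x \<union> Poly_Mapping.keys y"
  have "stable_count G (Poly_Mapping.lookup x i + Poly_Mapping.lookup y i) =
      stable_count G (Poly_Mapping.lookup x i) * (stable_count G (Poly_Mapping.lookup y i) :: 'a)" for i
    using assms
    by (cases "Poly_Mapping.lookup x i = 0"; cases "Poly_Mapping.lookup y i = 0")
      (auto simp: in_keys_iff disjoint_iff)
  then have "subset_sum (\<lambda>H. kromatic H (x + y)) G =
      subset_sum (\<lambda>H. kromatic H x) G * (subset_sum (\<lambda>H. kromatic H y) G :: 'a)"
    using keys_add[of x y]
    by (simp add: subset_sum_kromatic[of ?I] lookup_add prod.distrib)
  then show "subset_sum (\<lambda>H. kromatic H (x + y)) G =
      subset_sum (cover_sum (\<lambda>H K. kromatic H x * kromatic K y :: 'a)) G"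
    by (simp add: subset_sum_cover) (simp add: subset_sum_def sum_product)
qed

lemma subset_sum_bilinear:
  "subset_sum (\<lambda>G'. subset_sum (\<lambda>H'. \<Sum>x\<in>X. f x G' * g x H') H) G =
     (\<Sum>x\<in>X. subset_sum (f x) G * subset_sum (g x) H)"
proof -
  have "subset_sum (\<lambda>H'. \<Sum>x\<in>X. f x G' * g x H') H = (\<Sum>x\<in>X. f x G' * subset_sum (g x) H)" for G'
    unfolding subset_sum_def sum_distrib_left by (rule sum.swap)
  moreover have "subset_sum (\<lambda>G'. \<Sum>x\<in>X. f x G' * subset_sum (g x) H) G =
      (\<Sum>x\<in>X. subset_sum (f x) G * subset_sum (g x) H)"
    unfolding subset_sum_def[of _ G] sum_distrib_right by (rule sum.swap)
  ultimately show ?thesis by simp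
qed

text \<open>
  The identity \<open>p\<^sub>G\<^sub>\<squnion>\<^sub>H = p\<^sub>G p\<^sub>H\<close> of polynomials, coefficient by coefficient.
\<close>

lemma stable_count_disjoint_union:
  "stable_count (disjoint_union G H) n =
     (\<Sum>a\<le>n. stable_count G a * stable_count H (n - a) :: 'a::comm_ring_1)"
proof -
  let ?F = "\<lambda>n H. if edges H = {} \<and> card (verts H) = n then 1 else 0 :: 'a"
  have "?F n (disjoint_union G' H') = (\<Sum>a\<le>n. ?F a G' * ?F (n - a) H')" for G' H'
  proof -
    have "(\<Sum>a\<le>n. ?F a G' * ?F (n - a) H') =
        (\<Sum>a\<le>n. if a = card (verts G') then ?F a G' * ?F (n - a) H' else 0)"
      by (intro sum.cong) auto
    also have "\<dots> = ?F n (disjoint_union G' H')"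
      by (auto simp: edges_disjoint_union verts_disjoint_union_join card_join_sets finite_verts)
    finally show ?thesis by simp
  qed
  then have "subset_sum (?F n) (disjoint_union G H) =
      subset_sum (\<lambda>G'. subset_sum (\<lambda>H'. \<Sum>a\<le>n. ?F a G' * ?F (n - a) H') H) G"
    by (simp only: subset_sum_disjoint_union)
  also have "\<dots> = (\<Sum>a\<le>n. subset_sum (?F a) G * subset_sum (?F (n - a)) H)"
    by (rule subset_sum_bilinear)
  finally show ?thesis by (simp add: stable_count_subset_sum)
qed

text \<open>A factorization of a monomial distributes each exponent over the two factors.\<close>

lemma bij_betw_add_pairs:
  fixes x :: "'i \<Rightarrow>\<^sub>0 nat"
  shows "bij_betw (\<lambda>p. restrict (Poly_Mapping.lookup (fst p)) (Poly_Mapping.keys x))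
    {p. fst p + snd p = x} (PiE (Poly_Mapping.keys x) (\<lambda>i. {..Poly_Mapping.lookup x i}))"
proof -
  let ?X = "Poly_Mapping.keys x"
  let ?m = "\<lambda>g. \<Sum>i\<in>?X. Poly_Mapping.single i (g i) :: 'i \<Rightarrow>\<^sub>0 nat"
  have m: "Poly_Mapping.lookup (?m g) i = (if i \<in> ?X then g i else 0)" for g i
    by (simp add: lookup_sum lookup_single when_def)
  have x: "Poly_Mapping.lookup x i = Poly_Mapping.lookup (fst p) i + Poly_Mapping.lookup (snd p) i"
    if "fst p + snd p = x" for p i
    using that by (auto simp: lookup_add)
  show ?thesis
  proof (rule bij_betw_byWitness[where f' = "\<lambda>g. (?m g, ?m (\<lambda>i. Poly_Mapping.lookup x i - g i))"])
    show "\<forall>p\<in>{p. fst p + snd p = x}.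
        (?m (restrict (Poly_Mapping.lookup (fst p)) ?X),
         ?m (\<lambda>i. Poly_Mapping.lookup x i - restrict (Poly_Mapping.lookup (fst p)) ?X i)) = p"
    proof
      fix p assume p: "p \<in> {p. fst p + snd p = x}"
      have "?m (restrict (Poly_Mapping.lookup (fst p)) ?X) = fst p"
        by (rule poly_mapping_eqI) (use x[of p] p in \<open>auto simp: m in_keys_iff\<close>)
      moreover have "?m (\<lambda>i. Poly_Mapping.lookup x i - restrict (Poly_Mapping.lookup (fst p)) ?X i) = snd p"
        by (rule poly_mapping_eqI) (use x[of p] p in \<open>auto simp: m in_keys_iff\<close>)
      ultimately show "(?m (restrict (Poly_Mapping.lookup (fst p)) ?X),
         ?m (\<lambda>i. Poly_Mapping.lookup x i - restrict (Poly_Mapping.lookup (fst p)) ?X i)) = p"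
        by (simp only: prod.collapse)
    qed
    show "\<forall>g\<in>PiE ?X (\<lambda>i. {..Poly_Mapping.lookup x i}).
        restrict (Poly_Mapping.lookup (fst (?m g, ?m (\<lambda>i. Poly_Mapping.lookup x i - g i)))) ?X = g"
      by (auto simp: fun_eq_iff m PiE_iff extensional_def restrict_def)
    show "(\<lambda>p. restrict (Poly_Mapping.lookup (fst p)) ?X) ` {p. fst p + snd p = x}
        \<subseteq> PiE ?X (\<lambda>i. {..Poly_Mapping.lookup x i})"
      by (intro image_subsetI restrict_PiE_iff[THEN iffD2] ballI) (simp add: x)
    show "(\<lambda>g. (?m g, ?m (\<lambda>i. Poly_Mapping.lookup x i - g i))) `
        PiE ?X (\<lambda>i. {..Poly_Mapping.lookup x i}) \<subseteq> {p. fst p + snd p = x}"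
      by (auto simp: m lookup_add PiE_iff in_keys_iff intro!: poly_mapping_eqI)
  qed
qed

lemma finite_add_pairs: "finite {p. fst p + snd p = (x :: 'i \<Rightarrow>\<^sub>0 nat)}"
  using bij_betw_finite[OF bij_betw_add_pairs, of x] by (simp add: finite_PiE)

lemma keys_add_pair:
  fixes y z :: "'i \<Rightarrow>\<^sub>0 nat"
  shows "Poly_Mapping.keys (y + z) = Poly_Mapping.keys y \<union> Poly_Mapping.keys z"
  by (auto simp: in_keys_iff lookup_add)

text \<open>
  Multiplicativity of the kromatic functions. Taking subset sums in \<open>G\<close> and in \<open>H\<close> reduces it to
  \<open>\<Prod>i. p\<^sub>G\<^sub>\<squnion>\<^sub>H(x\<^sub>i) = (\<Prod>i. p\<^sub>G(x\<^sub>i)) (\<Prod>i. p\<^sub>H(x\<^sub>i))\<close>.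
\<close>

lemma kromatic_disjoint_union:
  "kromatic (disjoint_union G H) x =
     (\<Sum>p | fst p + snd p = x. kromatic G (fst p) * kromatic H (snd p) :: 'a::comm_ring_1)"
proof -
  let ?F = "\<lambda>G H. kromatic (disjoint_union G H) x :: 'a"
  let ?F' = "\<lambda>G H. \<Sum>p | fst p + snd p = x. kromatic G (fst p) * kromatic H (snd p) :: 'a"
  let ?X = "Poly_Mapping.keys x"
  let ?s = "\<lambda>G y i. stable_count G (Poly_Mapping.lookup y i) :: 'a"
  have "subset_sum (\<lambda>G'. subset_sum (\<lambda>H'. ?F G' H') H) G =
        subset_sum (\<lambda>G'. subset_sum (\<lambda>H'. ?F' G' H') H) G" for G H
  proof -
    have "subset_sum (\<lambda>G'. subset_sum (\<lambda>H'. ?F G' H') H) G = (\<Prod>i\<in>?X. ?s (disjoint_union G H) x i)"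
      unfolding subset_sum_disjoint_union[of "\<lambda>G. kromatic G x", symmetric]
      by (simp add: subset_sum_kromatic)
    also have "\<dots> = (\<Sum>g\<in>PiE ?X (\<lambda>i. {..Poly_Mapping.lookup x i}).
        \<Prod>i\<in>?X. stable_count G (g i) * stable_count H (Poly_Mapping.lookup x i - g i))"
      by (simp add: stable_count_disjoint_union prod_sum_PiE)
    also have "\<dots> = (\<Sum>p | fst p + snd p = x. (\<Prod>i\<in>?X. ?s G (fst p) i) * (\<Prod>i\<in>?X. ?s H (snd p) i))"
      by (subst sum.reindex_bij_betw[OF bij_betw_add_pairs, symmetric])
        (auto simp: lookup_add prod.distrib intro!: sum.cong)
    also have "\<dots> = (\<Sum>p | fst p + snd p = x.
        subset_sum (\<lambda>G'. kromatic G' (fst p)) G * subset_sum (\<lambda>H'. kromatic H' (snd p)) H)"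
      by (auto simp: subset_sum_kromatic[of ?X] keys_add_pair intro!: sum.cong)
    also have "\<dots> = subset_sum (\<lambda>G'. subset_sum (\<lambda>H'. ?F' G' H') H) G"
      by (rule subset_sum_bilinear[symmetric])
    finally show ?thesis .
  qed
  then have "subset_sum (\<lambda>H'. ?F G H') H = subset_sum (\<lambda>H'. ?F' G H') H" for H
    by (rule subset_sum_inject)
  then show ?thesis by (rule subset_sum_inject)
qed

section \<open>Quasisymmetric series and compositions\<close>

lemma increasing_indices_distinct: "is \<in> increasing_indices \<alpha> \<Longrightarrow> distinct is"
  by (simp add: increasing_indices_def strict_sorted_iff)

lemma length_increasing_indices: "is \<in> increasing_indices \<alpha> \<Longrightarrow> length is = length (parts \<alpha>)"
  by (simp add: increasing_indices_def)

lemma lookup_comp_monomial_nth: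
  assumes "is \<in> increasing_indices \<alpha>" "r < length (parts \<alpha>)"
  shows "Poly_Mapping.lookup (comp_monomial is \<alpha>) (is ! r) = parts \<alpha> ! r"
proof -
  have "Poly_Mapping.lookup (comp_monomial is \<alpha>) (is ! r) =
      (\<Sum>s<length (parts \<alpha>). if s = r then parts \<alpha> ! s else 0)"
    unfolding comp_monomial_def lookup_sum lookup_single when_def
    using assms increasing_indices_distinct[OF assms(1)] length_increasing_indices[OF assms(1)]
    by (intro sum.cong) (auto simp: nth_eq_iff_index_eq)
  then show ?thesis using assms(2) by simp
qed

lemma lookup_comp_monomial_notin:
  assumes "is \<in> increasing_indices \<alpha>" "i \<notin> set is"
  shows "Poly_Mapping.lookup (comp_monomial is \<alpha>) i = 0"
  unfolding comp_monomial_def lookup_sum lookup_single when_def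
  using assms length_increasing_indices[OF assms(1)] by (intro sum.neutral) (auto simp: in_set_conv_nth)

lemma parts_pos: "r < length (parts \<alpha>) \<Longrightarrow> 0 < parts \<alpha> ! r"
  using parts[of \<alpha>] by auto

lemma keys_comp_monomial:
  assumes "is \<in> increasing_indices \<alpha>"
  shows "Poly_Mapping.keys (comp_monomial is \<alpha>) = set is"
proof (intro equalityI subsetI)
  fix i assume "i \<in> set is"
  then obtain r where "r < length (parts \<alpha>)" "i = is ! r"
    using length_increasing_indices[OF assms] by (auto simp: in_set_conv_nth)
  then show "i \<in> Poly_Mapping.keys (comp_monomial is \<alpha>)"
    using parts_pos[of r \<alpha>] by (simp add: in_keys_iff lookup_comp_monomial_nth[OF assms])
next
  fix i assume "i \<in> Poly_Mapping.keys (comp_monomial is \<alpha>)"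
  then show "i \<in> set is"
    using lookup_comp_monomial_notin[OF assms, of i] by (auto simp: in_keys_iff)
qed

lemma map_lookup_comp_monomial:
  assumes "is \<in> increasing_indices \<alpha>"
  shows "map (Poly_Mapping.lookup (comp_monomial is \<alpha>)) is = parts \<alpha>"
  using lookup_comp_monomial_nth[OF assms] length_increasing_indices[OF assms]
  by (intro nth_equalityI) auto

text \<open>The composition \<open>\<alpha>\<close> such that the monomial \<open>x\<close> occurs in \<open>monomial_qsym \<alpha>\<close>.\<close>

definition shape :: "(nat \<Rightarrow>\<^sub>0 nat) \<Rightarrow> composition" where
  "shape x = Composition (map (Poly_Mapping.lookup x) (sorted_list_of_set (Poly_Mapping.keys x)))"

lemma parts_shape:
  "parts (shape x) = map (Poly_Mapping.lookup x) (sorted_list_of_set (Poly_Mapping.keys x))"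
  unfolding shape_def by (rule Composition_inverse) (auto simp: in_keys_iff)

lemma sorted_keys_increasing: "sorted_list_of_set (Poly_Mapping.keys x) \<in> increasing_indices (shape x)"
  by (simp add: increasing_indices_def parts_shape)

lemma comp_monomial_sorted_keys: "comp_monomial (sorted_list_of_set (Poly_Mapping.keys x)) (shape x) = x"
proof (rule poly_mapping_eqI)
  fix i
  let ?is = "sorted_list_of_set (Poly_Mapping.keys x)"
  show "Poly_Mapping.lookup (comp_monomial ?is (shape x)) i = Poly_Mapping.lookup x i"
  proof (cases "i \<in> Poly_Mapping.keys x")
    case True
    have "map (Poly_Mapping.lookup (comp_monomial ?is (shape x))) ?is = map (Poly_Mapping.lookup x) ?is"
      by (simp only: map_lookup_comp_monomial[OF sorted_keys_increasing] parts_shape)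
    then show ?thesis using True by simp
  next
    case False
    then show ?thesis
      by (simp add: lookup_comp_monomial_notin[OF sorted_keys_increasing] in_keys_iff)
  qed
qed

lemma comp_monomial_eq_iff:
  assumes "is \<in> increasing_indices \<alpha>"
  shows "comp_monomial is \<alpha> = x \<longleftrightarrow> is = sorted_list_of_set (Poly_Mapping.keys x) \<and> \<alpha> = shape x"
proof
  assume x: "comp_monomial is \<alpha> = x"
  have "sorted_list_of_set (set is) = is"
    using assms by (simp add: increasing_indices_def strict_sorted_iff sorted_list_of_set.idem_if_sorted_distinct)
  then have "is": "is = sorted_list_of_set (Poly_Mapping.keys x)"
    by (simp add: keys_comp_monomial[OF assms] flip: x)
  moreover have "parts \<alpha> = parts (shape x)"
    using map_lookup_comp_monomial[OF assms] unfolding x parts_shape "is"[symmetric] by simp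
  then have "\<alpha> = shape x" by (simp add: parts_inject)
  ultimately show "is = sorted_list_of_set (Poly_Mapping.keys x) \<and> \<alpha> = shape x" ..
qed (simp add: comp_monomial_sorted_keys)

lemma monomial_qsym_eq: "monomial_qsym \<alpha> x = (if \<alpha> = shape x then 1 else 0)"
proof -
  have "{is \<in> increasing_indices \<alpha>. comp_monomial is \<alpha> = x} =
      (if \<alpha> = shape x then {sorted_list_of_set (Poly_Mapping.keys x)} else {})"
    using sorted_keys_increasing by (auto simp: comp_monomial_eq_iff)
  then show ?thesis by (simp add: monomial_qsym_def)
qed

lemma upt_increasing: "[m..<m + length (parts \<alpha>)] \<in> increasing_indices \<alpha>"
  by (simp add: increasing_indices_def)

text \<open>
  The expansion \<open>f = \<Sum>\<alpha>. qsym_coeff f \<alpha> * M\<^sub>\<alpha>\<close>, since \<open>M\<^sub>\<alpha>\<close> with \<open>\<alpha> = shape x\<close> is the only one in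
  which \<open>x\<close> occurs.
\<close>

lemma quasisymmetric_expansion:
  assumes "quasisymmetric f"
  shows "f x = qsym_coeff f (shape x)"
proof -
  have "f (comp_monomial (sorted_list_of_set (Poly_Mapping.keys x)) (shape x)) =
      f (comp_monomial [0..<length (parts (shape x))] (shape x))"
    using assms[unfolded quasisymmetric_def, rule_format, OF sorted_keys_increasing
        upt_increasing[of 0 "shape x"]] by (simp only: add_0)
  then show ?thesis by (simp add: qsym_coeff_def comp_monomial_sorted_keys)
qed

lemma quasisymmetric_coeff:
  assumes "quasisymmetric f" "is \<in> increasing_indices \<alpha>"
  shows "f (comp_monomial is \<alpha>) = qsym_coeff f \<alpha>"
  using comp_monomial_eq_iff[OF assms(2), of "comp_monomial is \<alpha>"]
  by (simp add: quasisymmetric_expansion[OF assms(1)])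

lemma prod_fun_add_pairs:
  fixes f g :: "('i \<Rightarrow>\<^sub>0 nat) \<Rightarrow> 'a::semiring_0"
  shows "prod_fun f g x = (\<Sum>p | fst p + snd p = x. f (fst p) * g (snd p))"
proof -
  let ?P = "{p :: ('i \<Rightarrow>\<^sub>0 nat) \<times> ('i \<Rightarrow>\<^sub>0 nat). fst p + snd p = x}"
  have fin: "finite (fst ` ?P)" "finite (snd ` ?P)"
    by (simp_all add: finite_add_pairs)
  have inner: "Sum_any (\<lambda>q. g q when x = l + q) = (\<Sum>q\<in>snd ` ?P. g q when x = l + q)" for l
  proof (rule Sum_any.expand_superset[OF fin(2)], rule subsetI)
    fix q assume "q \<in> {q. (g q when x = l + q) \<noteq> 0}"
    then show "q \<in> snd ` ?P" by (intro image_eqI[of _ _ "(l, q)"]) auto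
  qed
  have "prod_fun f g x = (\<Sum>l\<in>fst ` ?P. f l * (\<Sum>q\<in>snd ` ?P. g q when x = l + q))"
    unfolding prod_fun_def inner
  proof (rule Sum_any.expand_superset[OF fin(1)], rule subsetI)
    fix l assume "l \<in> {l. f l * (\<Sum>q\<in>snd ` ?P. g q when x = l + q) \<noteq> 0}"
    then have "(\<Sum>q\<in>snd ` ?P. g q when x = l + q) \<noteq> 0" by force
    then obtain q where "(g q when x = l + q) \<noteq> 0" by (rule sum.not_neutral_contains_not_neutral)
    then show "l \<in> fst ` ?P" by (intro image_eqI[of _ _ "(l, q)"]) (auto simp: when_def split: if_splits)
  qed
  also have "\<dots> = (\<Sum>p\<in>fst ` ?P \<times> snd ` ?P. f (fst p) * g (snd p) when fst p + snd p = x)"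
    by (simp add: sum_distrib_left sum.cartesian_product case_prod_unfold mult_when eq_commute[of x])
  also have "\<dots> = (\<Sum>p\<in>?P. f (fst p) * g (snd p))"
  proof (rule sum.mono_neutral_cong_right)
    show "finite (fst ` ?P \<times> snd ` ?P)" by (intro finite_cartesian_product fin)
    show "?P \<subseteq> fst ` ?P \<times> snd ` ?P"
      by (rule subsetI) (simp only: mem_Times_iff imageI simp_thms)
  qed (simp_all add: when_def)
  finally show ?thesis .
qed

text \<open>
  Each pair of monomials with product \<open>x\<close> occurs in exactly one product \<open>M\<^sub>\<alpha> M\<^sub>\<beta>\<close>, so a possibly
  infinite combination of these products has finite sums as coefficients.
\<close>

lemma qsym_mult_kernel:
  fixes \<Phi> :: "composition \<times> composition \<Rightarrow> 'k::comm_ring_1"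
  defines "W \<equiv> (\<lambda>(\<alpha>, \<beta>). prod_fun (monomial_qsym \<alpha>) (monomial_qsym \<beta>)) :: _ \<Rightarrow> 'k series"
  shows "column_finite W"
    and "cont_ext W \<Phi> x = (\<Sum>p | fst p + snd p = x. \<Phi> (shape (fst p), shape (snd p)))"
proof -
  let ?A = "\<lambda>x. (\<lambda>p. (shape (fst p), shape (snd p))) ` {p. fst p + snd p = x}"
  have W: "W q x = (\<Sum>p | fst p + snd p = x. if q = (shape (fst p), shape (snd p)) then 1 else 0)" for q x
    by (cases q) (auto simp: W_def prod_fun_add_pairs monomial_qsym_eq intro!: sum.cong)
  have fin: "finite (?A x)" for x
    by (intro finite_imageI finite_add_pairs)
  have supp: "{q. W q x \<noteq> 0} \<subseteq> ?A x" for x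
  proof
    fix q assume "q \<in> {q. W q x \<noteq> 0}"
    then have "(\<Sum>p | fst p + snd p = x. if q = (shape (fst p), shape (snd p)) then 1 else 0) \<noteq> (0 :: 'k)"
      by (simp add: W)
    then show "q \<in> ?A x"
      by (rule sum.not_neutral_contains_not_neutral) (simp split: if_splits)
  qed
  show "column_finite W"
    unfolding column_finite_def by (intro allI finite_subset[OF supp fin])
  have "cont_ext W \<Phi> x = (\<Sum>q\<in>?A x. \<Sum>p | fst p + snd p = x. if q = (shape (fst p), shape (snd p)) then \<Phi> q else 0)"
    by (subst cont_ext_superset[OF fin supp]) (auto simp: W sum_distrib_left intro!: sum.cong)
  also have "\<dots> = (\<Sum>p | fst p + snd p = x. \<Phi> (shape (fst p), shape (snd p)))"
    by (subst sum.swap) (auto simp: fin intro!: sum.cong)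
  finally show "cont_ext W \<Phi> x = (\<Sum>p | fst p + snd p = x. \<Phi> (shape (fst p), shape (snd p)))" .
qed

text \<open>
  The tensor \<open>M\<^sub>\<alpha> \<otimes> M\<^sub>\<beta>\<close> occurs in the coproduct of exactly one \<open>M\<^sub>\<gamma>\<close>, that with \<open>\<gamma> = \<alpha>\<beta>\<close>.
\<close>

lemma qsym_comult_kernel:
  fixes g :: "composition \<Rightarrow> 'k::comm_ring_1"
  shows "cont_ext (\<lambda>\<gamma>. \<Sum>(\<alpha>, \<beta>) | comp_append \<alpha> \<beta> = \<gamma>. delta (\<alpha>, \<beta>)) g (\<alpha>, \<beta>) = g (comp_append \<alpha> \<beta>)"
proof -
  have fin: "finite {(\<alpha>, \<beta>). comp_append \<alpha> \<beta> = \<gamma>}" for \<gamma>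
  proof (rule finite_imageD)
    have "(\<lambda>(\<alpha>, \<beta>). (parts \<alpha>, parts \<beta>)) ` {(\<alpha>, \<beta>). comp_append \<alpha> \<beta> = \<gamma>} \<subseteq>
        (\<lambda>n. (take n (parts \<gamma>), drop n (parts \<gamma>))) ` {..length (parts \<gamma>)}"
    proof clarify
      fix \<alpha> \<beta>
      show "(parts \<alpha>, parts \<beta>) \<in> (\<lambda>n. (take n (parts (comp_append \<alpha> \<beta>)), drop n (parts (comp_append \<alpha> \<beta>)))) `
          {..length (parts (comp_append \<alpha> \<beta>))}"
        by (rule image_eqI[of _ _ "length (parts \<alpha>)"]) (simp_all add: comp_append.rep_eq)
    qed
    then show "finite ((\<lambda>(\<alpha>, \<beta>). (parts \<alpha>, parts \<beta>)) ` {(\<alpha>, \<beta>). comp_append \<alpha> \<beta> = \<gamma>})"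
      by (rule finite_subset) simp
    show "inj_on (\<lambda>(\<alpha>, \<beta>). (parts \<alpha>, parts \<beta>)) {(\<alpha>, \<beta>). comp_append \<alpha> \<beta> = \<gamma>}"
      by (rule inj_onI) (simp add: case_prod_unfold parts_inject prod_eq_iff)
  qed
  define V :: "composition \<Rightarrow> composition \<times> composition \<Rightarrow> 'k" where
    "V = (\<lambda>\<gamma>. \<Sum>(\<alpha>, \<beta>) | comp_append \<alpha> \<beta> = \<gamma>. delta (\<alpha>, \<beta>))"
  have kernel: "V \<gamma> (\<alpha>, \<beta>) =
      (if \<gamma> = comp_append \<alpha> \<beta> then 1 else 0 :: 'k)" for \<gamma>
  proof -
    have "V \<gamma> (\<alpha>, \<beta>) =
        (\<Sum>p\<in>{(\<alpha>, \<beta>). comp_append \<alpha> \<beta> = \<gamma>}. if p = (\<alpha>, \<beta>) then 1 else 0 :: 'k)"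
      unfolding V_def sum_fun_apply by (intro sum.cong) (auto simp: delta_def)
    then show ?thesis using fin[of \<gamma>] by auto
  qed
  have "cont_ext V g (\<alpha>, \<beta>) = g (comp_append \<alpha> \<beta>)"
    by (subst cont_ext_superset[of "{comp_append \<alpha> \<beta>}"]) (auto simp: kernel)
  then show ?thesis by (simp only: V_def)
qed

lemma comp_monomial_append:
  "comp_monomial [0..<length (parts (comp_append \<alpha> \<beta>))] (comp_append \<alpha> \<beta>) =
     comp_monomial [0..<length (parts \<alpha>)] \<alpha> +
     comp_monomial [length (parts \<alpha>)..<length (parts \<alpha>) + length (parts \<beta>)] \<beta>"
proof -
  have split: "(\<Sum>r<m + n. f r) = (\<Sum>r<m. f r) + (\<Sum>r<n. f (m + r))" for f :: "nat \<Rightarrow> nat \<Rightarrow>\<^sub>0 nat" and m n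
    by (induction n) (auto simp: add.assoc)
  show ?thesis
    unfolding comp_monomial_def by (simp add: comp_append.rep_eq split nth_append)
qed

text \<open>
  The product \<open>\<Prod>i. p\<^sub>G(x\<^sub>i)\<close> depends only on the exponents of the monomial and not on its variables.
\<close>

lemma quasisymmetric_kromatic: "quasisymmetric (kromatic G :: 'a::comm_ring_1 series)"
  unfolding quasisymmetric_def
proof (intro allI ballI)
  fix \<alpha> "is" js
  assume inc: "is \<in> increasing_indices \<alpha>" "js \<in> increasing_indices \<alpha>"
  have prod: "subset_sum (\<lambda>H. kromatic H (comp_monomial is \<alpha>)) G =
      (\<Prod>r<length (parts \<alpha>). stable_count G (parts \<alpha> ! r) :: 'a)"
    if "is \<in> increasing_indices \<alpha>" for "is" G
  proof -
    have "bij_betw ((!) is) {..<length (parts \<alpha>)} (set is)"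
      using increasing_indices_distinct[OF that] length_increasing_indices[OF that]
      by (intro bij_betw_nth) auto
    then have "(\<Prod>i\<in>set is. stable_count G (Poly_Mapping.lookup (comp_monomial is \<alpha>) i)) =
        (\<Prod>r<length (parts \<alpha>). stable_count G (Poly_Mapping.lookup (comp_monomial is \<alpha>) (is ! r)) :: 'a)"
      by (rule prod.reindex_bij_betw[symmetric])
    then show ?thesis
      by (subst subset_sum_kromatic[of "set is"])
        (simp_all add: keys_comp_monomial[OF that] lookup_comp_monomial_nth[OF that])
  qed
  show "kromatic G (comp_monomial is \<alpha>) = (kromatic G (comp_monomial js \<alpha>) :: 'a)"
    by (rule subset_sum_inject[of "\<lambda>G. kromatic G (comp_monomial is \<alpha>)"
          "\<lambda>G. kromatic G (comp_monomial js \<alpha>)"]) (simp only: prod[OF inc(1)] prod[OF inc(2)])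
qed

text \<open>
  The monomial for \<open>\<alpha>\<beta>\<close> is the product of the monomials for \<open>\<alpha>\<close> and \<open>\<beta>\<close> in disjoint sets of
  variables; those of the second need not be the initial ones, by quasisymmetry.
\<close>

lemma qsym_coeff_kromatic_append:
  "qsym_coeff (kromatic G) (comp_append \<alpha> \<beta>) =
     cover_sum (\<lambda>H K. qsym_coeff (kromatic H) \<alpha> * qsym_coeff (kromatic K) \<beta> :: 'a::comm_ring_1) G"
proof -
  have "Poly_Mapping.keys (comp_monomial [0..<length (parts \<alpha>)] \<alpha>) \<inter>
      Poly_Mapping.keys (comp_monomial [length (parts \<alpha>)..<length (parts \<alpha>) + length (parts \<beta>)] \<beta>) = {}"
    using keys_comp_monomial[OF upt_increasing, of 0 \<alpha>]
      keys_comp_monomial[OF upt_increasing, of "length (parts \<alpha>)" \<beta>] by auto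
  then show ?thesis
    by (simp add: qsym_coeff_def[of _ "comp_append \<alpha> \<beta>"] comp_monomial_append kromatic_add_disjoint
        quasisymmetric_coeff[OF quasisymmetric_kromatic upt_increasing]
        quasisymmetric_coeff[OF quasisymmetric_kromatic upt_increasing[of 0], simplified])
qed

section \<open>Morphisms into quasisymmetric series\<close>

text \<open>
  The conditions defining a pseudobasis element prescribe a functional on the basis of the predual,
  and an LC-module contains exactly one element for each functional.
\<close>

lemma pseudobasis_mem:
  fixes B :: "('i, 'b::ab_group_add, 'k::idom, 'z) lc_module_scheme"
  assumes "is_lc_module B"
  shows "pseudobasis B i \<in> lc_carrier B"
proof -
  have hom: "module_hom free_scale (*) (\<lambda>a. lc_pair B a b)" if "b \<in> lc_carrier B" for b
    using assms that unfolding is_lc_module_def bij_betw_def by blast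
  have inj: "inj_on (\<lambda>b a. lc_pair B a b) (lc_carrier B)"
    and img: "(\<lambda>b a. lc_pair B a b) ` lc_carrier B = {\<phi>. module_hom free_scale (*) \<phi>}"
    using assms unfolding is_lc_module_def bij_betw_def by blast+
  let ?P = "\<lambda>b. b \<in> lc_carrier B \<and> (\<forall>j. lc_pair B (basis j) b = (if j = i then 1 else 0))"
  have "(\<lambda>a. std_pair a (delta i)) \<in> (\<lambda>b a. lc_pair B a b) ` lc_carrier B"
    unfolding img by (simp only: mem_Collect_eq module_hom_pair)
  then obtain b where b: "b \<in> lc_carrier B" "(\<lambda>a. std_pair a (delta i)) = (\<lambda>a. lc_pair B a b)"
    by (rule imageE) simp
  have "?P b"
    using b(1) fun_cong[OF b(2), of "basis _"] by (simp add: lookup_single when_def eq_commute)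
  moreover have "b' = b" if "?P b'" for b'
  proof (rule inj_onD[OF inj])
    show "(\<lambda>a. lc_pair B a b') = (\<lambda>a. lc_pair B a b)"
    proof
      fix a
      show "lc_pair B a b' = lc_pair B a b"
        using that \<open>?P b\<close> module_hom_eq_pair[OF hom, of b' a] module_hom_eq_pair[OF hom, of b a] by simp
    qed
  qed (use that b(1) in blast)+
  ultimately have "?P (pseudobasis B i)"
    unfolding pseudobasis_def by (intro theI[of ?P b])
  then show ?thesis by blast
qed

lemma comp_append_induct:
  assumes "P (Composition [])" "\<And>a. 0 < a \<Longrightarrow> P (Composition [a])"
    and "\<And>\<alpha> \<beta>. P \<alpha> \<Longrightarrow> P \<beta> \<Longrightarrow> P (comp_append \<alpha> \<beta>)"
  shows "P \<gamma>"
proof -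
  have "P (Composition as)" if "\<forall>a\<in>set as. 0 < a" for as
    using that
  proof (induction as)
    case (Cons a as)
    then have "Composition (a # as) = comp_append (Composition [a]) (Composition as)"
      by (simp add: comp_append.rep_eq Composition_inverse flip: parts_inject)
    then show ?case using Cons assms(2,3) by simp
  qed (rule assms(1))
  from this[of "parts \<gamma>"] show ?thesis
    using parts[of \<gamma>] by (simp add: parts_inverse)
qed

lemma qsym_coeff_Nil: "qsym_coeff f (Composition []) = f 0"
  by (simp add: qsym_coeff_def comp_monomial_def Composition_inverse)

lemma qsym_coeff_singleton: "0 < a \<Longrightarrow> qsym_coeff f (Composition [a]) = f (Poly_Mapping.single 0 a)"
  by (simp add: qsym_coeff_def comp_monomial_def Composition_inverse)

lemma qsym_coeff_comult: "lc_comult mQSym f (\<alpha>, \<beta>) = qsym_coeff f (comp_append \<alpha> \<beta>)"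
  by (simp only: mQSym_def lc_bialgebra.select_convs qsym_comult_kernel)

lemma lc_pair_basis_mQSym: "lc_pair mQSym (basis \<alpha>) f = qsym_coeff f \<alpha>"
  by (simp add: mQSym_def)

lemma lc_tensor_map_mQSym:
  "lc_tensor_map H mQSym H mQSym f f \<Phi> (\<alpha>, \<beta>) =
     cont_ext (\<lambda>p _. qsym_coeff (f (pseudobasis H (fst p))) \<alpha> * qsym_coeff (f (pseudobasis H (snd p))) \<beta>) \<Phi> ()"
  by (simp add: lc_tensor_map_def cont_ext_def lc_pair_basis_mQSym case_prod_unfold)

text \<open>
  The coefficients of \<open>\<Psi> b\<close> for the empty composition and for those with one part are given by the
  counit and by \<open>\<zeta>\<close>, and the coefficient for \<open>\<alpha>\<beta>\<close> is a coefficient of \<open>(\<Psi> \<otimes> \<Psi>)(\<Delta> b)\<close>, which only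
  involves the coefficients of values of \<open>\<Psi>\<close> for \<open>\<alpha>\<close> and \<open>\<beta>\<close>.
\<close>

lemma combinatorial_lc_hopf_morphism_unique:
  assumes lc: "is_lc_module H"
    and \<Psi>: "combinatorial_lc_hopf_morphism H \<zeta> mQSym zeta_Q \<Psi>"
    and \<Psi>': "combinatorial_lc_hopf_morphism H \<zeta> mQSym zeta_Q \<Psi>'"
    and b: "b \<in> lc_carrier H"
  shows "\<Psi> b = \<Psi>' b"
proof -
  have eq: "qsym_coeff (\<Psi> b) \<gamma> = qsym_coeff (\<Psi>' b) \<gamma>" if "b \<in> lc_carrier H" for b \<gamma>
    using that
  proof (induction \<gamma> arbitrary: b rule: comp_append_induct)
    case 1
    have "qsym_coeff (F b) (Composition []) = lc_counit H b"
      if "combinatorial_lc_hopf_morphism H \<zeta> mQSym zeta_Q F" for F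
      using that 1 unfolding combinatorial_lc_hopf_morphism_def lc_hopf_morphism_def
      by (simp add: qsym_coeff_Nil mQSym_def)
    then show ?case using \<Psi> \<Psi>' by simp
  next
    case (2 a)
    have "qsym_coeff (F b) (Composition [a]) = fps_nth (\<zeta> b) a"
      if "combinatorial_lc_hopf_morphism H \<zeta> mQSym zeta_Q F" for F
      using that 2 unfolding combinatorial_lc_hopf_morphism_def
      by (simp add: qsym_coeff_singleton zeta_Q_def)
    then show ?case using \<Psi> \<Psi>' by simp
  next
    case (3 \<alpha> \<beta>)
    have "qsym_coeff (F b) (comp_append \<alpha> \<beta>) =
        lc_tensor_map H mQSym H mQSym F F (lc_comult H b) (\<alpha>, \<beta>)"
      if "combinatorial_lc_hopf_morphism H \<zeta> mQSym zeta_Q F" for F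
      using that 3(3) unfolding combinatorial_lc_hopf_morphism_def lc_hopf_morphism_def
      by (simp flip: qsym_coeff_comult)
    then show ?case
      using \<Psi> \<Psi>' 3(1,2)[OF pseudobasis_mem[OF lc]] by (simp add: lc_tensor_map_mQSym)
  qed
  have "quasisymmetric (F b)" if "combinatorial_lc_hopf_morphism H \<zeta> mQSym zeta_Q F" for F
    using that b unfolding combinatorial_lc_hopf_morphism_def lc_hopf_morphism_def
      lc_algebra_hom_def lc_continuous_linear_def by (auto simp: mQSym_def)
  then show ?thesis
    using \<Psi> \<Psi>' by (simp add: fun_eq_iff quasisymmetric_expansion eq[OF b])
qed

section \<open>The kromatic morphism\<close>

lemma pseudobasis_mGraphs: "pseudobasis mGraphs C = (delta C :: graph_class \<Rightarrow> 'k::idom)"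
  unfolding pseudobasis_def
  by (rule the_equality) (auto simp: mGraphs_def delta_def fun_eq_iff)

definition kromatic_class :: "graph_class \<Rightarrow> 'k::comm_ring_1 series" where
  "kromatic_class C = kromatic (class_rep C)"

lemma kromatic_class_iso_class [simp]: "kromatic_class (iso_class G) = kromatic G"
  unfolding kromatic_class_def
  by (rule kromatic_iso_invariant) (rule Quotient_abs_rep[OF Quotient_graph_class])

text \<open>
  Every vertex needs a color, so only graphs with at most \<open>deg x\<close> vertices contribute to the
  coefficient of the monomial \<open>x\<close>.
\<close>

lemma column_finite_kromatic: "column_finite (kromatic_class :: _ \<Rightarrow> 'k::comm_ring_1 series)"
  unfolding column_finite_def
proof
  fix x
  have "{C. kromatic_class C x \<noteq> (0 :: 'k)} \<subseteq>
      {C. class_order C \<le> (\<Sum>i\<in>Poly_Mapping.keys x. Poly_Mapping.lookup x i)}"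
  proof
    fix C assume "C \<in> {C. kromatic_class C x \<noteq> (0 :: 'k)}"
    then show "C \<in> {C. class_order C \<le> (\<Sum>i\<in>Poly_Mapping.keys x. Poly_Mapping.lookup x i)}"
      by (cases C rule: iso_class_cases) (simp add: kromatic_nonzero_card_verts)
  qed
  then show "finite {C. kromatic_class C x \<noteq> (0 :: 'k)}"
    by (rule finite_subset) (rule finite_class_order_le)
qed

lemma column_finite_product:
  fixes v :: "'i \<Rightarrow> 'p \<Rightarrow> 'k::comm_ring_1" and w :: "'j \<Rightarrow> 'q \<Rightarrow> 'k"
  assumes "column_finite v" "column_finite w"
  shows "column_finite (\<lambda>(i, j) (p, q). v i p * w j q)"
  unfolding column_finite_def
proof
  fix x :: "'p \<times> 'q"
  have "{y. (case y of (i, j) \<Rightarrow> \<lambda>(p, q). v i p * w j q) x \<noteq> 0} \<subseteq>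
      {i. v i (fst x) \<noteq> 0} \<times> {j. w j (snd x) \<noteq> 0}"
    by (auto simp: case_prod_unfold)
  then show "finite {y. (case y of (i, j) \<Rightarrow> \<lambda>(p, q). v i p * w j q) x \<noteq> 0}"
    by (rule finite_subset) (use assms in \<open>simp add: column_finite_def\<close>)
qed

lemma column_finite_comp: "column_finite v \<Longrightarrow> column_finite (\<lambda>i j. v i (g j))"
  by (simp add: column_finite_def)

lemma lc_one_mGraphs [simp]: "lc_one mGraphs = delta empty_class"
  and lc_carrier_mGraphs [simp]: "lc_carrier mGraphs = UNIV"
  and lc_mult_mGraphs: "lc_mult mGraphs = cont_ext (\<lambda>(C, D). delta (class_union C D))"
  and lc_comult_mGraphs: "lc_comult mGraphs = cont_ext class_coproduct"
  and lc_scale_mGraphs: "lc_scale mGraphs = (\<lambda>c f C. c * f C)"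
  and lc_pair_mGraphs: "lc_pair mGraphs = std_pair"
  and lc_counit_mGraphs: "lc_counit mGraphs = (\<lambda>f. cont_ext (\<lambda>C _. 0 ^ class_order C) f ())"
  by (simp_all add: mGraphs_def)

lemma cont_ext_mult_mGraphs:
  assumes "column_finite v"
  shows "cont_ext v (lc_mult mGraphs \<phi>) = cont_ext (\<lambda>(C, D). v (class_union C D)) \<phi>"
proof -
  have "(\<lambda>p. cont_ext v (case p of (C, D) \<Rightarrow> delta (class_union C D))) =
      (\<lambda>(C, D). v (class_union C D))"
    by (auto simp: fun_eq_iff cont_ext_delta[OF assms])
  then show ?thesis
    by (simp add: lc_mult_mGraphs cont_ext_cont_ext(1)[OF column_finite_class_union assms])
qed

definition zeta_kernel :: "graph_class \<Rightarrow> nat \<Rightarrow> 'k::comm_ring_1" where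
  "zeta_kernel C = fps_nth (0 ^ class_size C * fps_X ^ class_order C)"

lemma zeta_kernel_eq: "zeta_kernel C n = (if class_size C = 0 \<and> class_order C = n then 1 else 0)"
  by (cases "class_size C = 0") (auto simp: zeta_kernel_def power_0_left)

lemma column_finite_zeta_kernel: "column_finite (zeta_kernel :: _ \<Rightarrow> _ \<Rightarrow> 'k::comm_ring_1)"
  unfolding column_finite_def
  by (intro allI finite_subset[OF _ finite_class_order_le]) (auto simp: zeta_kernel_eq split: if_splits)

lemma zeta_Graphs_kernel: "zeta_Graphs f = Abs_fps (cont_ext zeta_kernel f)"
  by (simp add: zeta_Graphs_def zeta_kernel_def[abs_def])

lemma lc_continuous_linear_mGraphs:
  assumes v: "column_finite v"
    and img: "f ` UNIV \<subseteq> lc_carrier B"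
    and lin: "linear_on_carrier UNIV (\<lambda>c f C. c * f C) (lc_scale B) f"
    and pair: "\<And>a b. lc_pair B a (f b) = std_pair a (cont_ext v b)"
  shows "lc_continuous_linear mGraphs B f"
  unfolding lc_continuous_linear_def
proof (intro conjI continuous_map_lc_adjoint)
  show "\<exists>a'. \<forall>b\<in>lc_carrier mGraphs. lc_pair B a (f b) = lc_pair mGraphs a' b" for a
    by (intro exI[of _ "predual_map v a"] ballI)
      (simp add: pair lc_pair_mGraphs std_pair_predual_map[OF v])
qed (use img lin in \<open>simp_all add: lc_scale_mGraphs\<close>)

lemma cont_ext_power_series_mult:
  fixes f g :: "'k::comm_ring_1 fps"
  defines "P \<equiv> (\<lambda>(i, j). fps_nth (fps_X ^ i * fps_X ^ j)) :: nat \<times> nat \<Rightarrow> nat \<Rightarrow> 'k"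
  shows "column_finite P"
    and "cont_ext P (\<lambda>(i, j). fps_nth f i * fps_nth g j) = fps_nth (f * g)"
proof -
  let ?A = "\<lambda>n. (\<lambda>i. (i, n - i)) ` {0..n::nat}"
  have P: "P (i, j) n = (if i + j = n then 1 else 0)" for i j n
    by (auto simp: P_def simp flip: power_add)
  have supp: "{p. P p n \<noteq> 0} \<subseteq> ?A n" for n
  proof
    fix p assume "p \<in> {p. P p n \<noteq> 0}"
    then show "p \<in> ?A n"
      by (cases p) (auto simp: P image_iff split: if_splits)
  qed
  show "column_finite P"
    unfolding column_finite_def by (intro allI finite_subset[OF supp]) simp
  show "cont_ext P (\<lambda>(i, j). fps_nth f i * fps_nth g j) = fps_nth (f * g)"
  proof
    fix n
    have "cont_ext P (\<lambda>(i, j). fps_nth f i * fps_nth g j) n =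
        (\<Sum>i=0..n. fps_nth f i * fps_nth g (n - i) * P (i, n - i) n)"
      by (subst cont_ext_superset[OF _ supp])
        (simp_all add: sum.reindex inj_on_def)
    then show "cont_ext P (\<lambda>(i, j). fps_nth f i * fps_nth g j) n = fps_nth (f * g) n"
      by (simp add: P fps_mult_nth)
  qed
qed

lemma combinatorial_lc_hopf_algebra_mGraphs:
  "combinatorial_lc_hopf_algebra
     (mGraphs :: (graph_class, graph_class \<Rightarrow> 'k, 'k::idom) lc_bialgebra) zeta_Graphs"
proof -
  let ?z = "zeta_kernel :: graph_class \<Rightarrow> nat \<Rightarrow> 'k"
  let ?H = "mGraphs :: (graph_class, graph_class \<Rightarrow> 'k, 'k) lc_bialgebra"
  let ?R = "lc_power_series :: (nat, 'k fps, 'k) lc_algebra"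
  let ?T = "\<lambda>(C, D) (i, j). ?z C i * ?z D j"
  let ?P = "(\<lambda>(i, j). fps_nth (fps_X ^ i * fps_X ^ j)) :: nat \<times> nat \<Rightarrow> nat \<Rightarrow> 'k"
  note z = column_finite_zeta_kernel
  have cont: "lc_continuous_linear ?H ?R zeta_Graphs"
  proof (rule lc_continuous_linear_mGraphs[OF z])
    show "linear_on_carrier UNIV (\<lambda>c f C. c * f C) (lc_scale ?R) (zeta_Graphs :: (graph_class \<Rightarrow> 'k) \<Rightarrow> _)"
      by (auto simp: linear_on_carrier_def zeta_Graphs_kernel lc_power_series_def fps_eq_iff
          cont_ext_add cont_ext_scale)
  qed (simp_all add: lc_power_series_def zeta_Graphs_kernel Abs_fps_inverse)
  have tensor: "lc_tensor_map ?H ?R ?H ?R zeta_Graphs zeta_Graphs = cont_ext ?T"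
    unfolding lc_tensor_map_def pseudobasis_mGraphs
    by (simp add: zeta_Graphs_kernel lc_power_series_def cont_ext_delta[OF z])
  have kernel: "cont_ext ?P (?T (C, D)) = ?z (class_union C D)" for C D
  proof -
    have "cont_ext ?P (?T (C, D)) = fps_nth (Abs_fps (?z C) * Abs_fps (?z D))"
      using cont_ext_power_series_mult(2)[of "Abs_fps (?z C)" "Abs_fps (?z D)"] by simp
    also have "Abs_fps (?z C) * Abs_fps (?z D) = Abs_fps (?z (class_union C D))"
      by (simp add: zeta_kernel_def fps_nth_inverse class_size_union class_order_union power_add mult_ac)
    finally show ?thesis by simp
  qed
  have mult: "zeta_Graphs (lc_mult ?H \<phi>) = lc_mult ?R (cont_ext ?T \<phi>)" for \<phi>
  proof -
    have "cont_ext ?P (cont_ext ?T \<phi>) = cont_ext (\<lambda>p. cont_ext ?P (?T p)) \<phi>"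
      by (rule cont_ext_cont_ext(1)[OF column_finite_product[OF z z] cont_ext_power_series_mult(1)])
    also have "(\<lambda>p. cont_ext ?P (?T p)) = (\<lambda>(C, D). ?z (class_union C D))"
      using kernel by (simp add: fun_eq_iff split_paired_all)
    finally show ?thesis
      by (simp add: zeta_Graphs_kernel cont_ext_mult_mGraphs[OF z] lc_power_series_def)
  qed
  have one: "zeta_Graphs (lc_one ?H) = lc_one ?R"
    by (simp add: zeta_Graphs_kernel cont_ext_delta[OF z] zeta_kernel_def lc_power_series_def fps_nth_inverse)
  have counit: "fps_nth (zeta_Graphs b) 0 = lc_counit ?H b" for b
  proof -
    have "?z C 0 = 0 ^ class_order C" for C
      by (cases "class_order C = 0") (auto simp: zeta_kernel_eq zero_power_eq)
    then show ?thesis by (simp add: zeta_Graphs_kernel lc_counit_mGraphs cont_ext_def)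
  qed
  show ?thesis
    unfolding combinatorial_lc_hopf_algebra_def lc_algebra_hom_def
    by (intro conjI allI ballI lc_hopf_algebra_mGraphs cont one counit) (simp only: tensor mult)
qed

text \<open>
  By continuity the conditions on a morphism have to be checked on graphs only. There the products
  are \<open>kromatic_disjoint_union\<close>, the coproducts are \<open>qsym_coeff_kromatic_append\<close>, and the character
  and the counit are \<open>kromatic_single\<close>.
\<close>

lemma combinatorial_lc_hopf_morphism_kromatic:
  "combinatorial_lc_hopf_morphism
     (mGraphs :: (graph_class, graph_class \<Rightarrow> 'k, 'k::idom) lc_bialgebra) zeta_Graphs
     mQSym zeta_Q (cont_ext kromatic_class)"
proof -
  let ?K = "kromatic_class :: graph_class \<Rightarrow> 'k series"
  let ?H = "mGraphs :: (graph_class, graph_class \<Rightarrow> 'k, 'k) lc_bialgebra"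
  let ?Q = "mQSym :: (composition, 'k series, 'k) lc_bialgebra"
  let ?c = "\<lambda>C. qsym_coeff (?K C)"
  let ?T = "\<lambda>(C, D) (\<alpha>, \<beta>). ?c C \<alpha> * ?c D \<beta>"
  let ?W = "(\<lambda>(\<alpha>, \<beta>). prod_fun (monomial_qsym \<alpha>) (monomial_qsym \<beta>)) :: _ \<Rightarrow> 'k series"
  note K = column_finite_kromatic
  have c: "column_finite ?c"
    unfolding qsym_coeff_def by (rule column_finite_comp[OF K])
  have coeff: "qsym_coeff (cont_ext ?K b) = cont_ext ?c b" for b
    by (simp add: fun_eq_iff qsym_coeff_def cont_ext_def)
  have quasi: "quasisymmetric (?K C)" for C
    by (simp add: kromatic_class_def quasisymmetric_kromatic)
  have quasi_ext: "quasisymmetric (cont_ext ?K b)" for b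
    unfolding quasisymmetric_def
  proof (intro allI ballI)
    fix \<alpha> "is" js
    assume "is \<in> increasing_indices \<alpha>" "js \<in> increasing_indices \<alpha>"
    then have "?K C (comp_monomial is \<alpha>) = ?K C (comp_monomial js \<alpha>)" for C
      by (simp only: quasisymmetric_coeff[OF quasi])
    then show "cont_ext ?K b (comp_monomial is \<alpha>) = cont_ext ?K b (comp_monomial js \<alpha>)"
      by (simp only: cont_ext_def)
  qed
  have cont: "lc_continuous_linear ?H ?Q (cont_ext ?K)"
  proof (rule lc_continuous_linear_mGraphs[OF c])
    show "range (cont_ext ?K) \<subseteq> lc_carrier ?Q"
      using quasi_ext by (auto simp: mQSym_def)
    show "linear_on_carrier UNIV (\<lambda>c f C. c * f C) (lc_scale ?Q) (cont_ext ?K)"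
      by (auto simp: linear_on_carrier_def mQSym_def fun_eq_iff cont_ext_add cont_ext_scale)
  qed (simp add: mQSym_def coeff)
  have tensor: "lc_tensor_map ?H ?Q ?H ?Q (cont_ext ?K) (cont_ext ?K) = cont_ext ?T"
    unfolding lc_tensor_map_def pseudobasis_mGraphs
    by (simp add: lc_pair_basis_mQSym cont_ext_delta[OF K])
  have mult_kernel: "cont_ext ?W (?T (C, D)) = ?K (class_union C D)" for C D
  proof
    fix x
    obtain G H where CD: "C = iso_class G" "D = iso_class H" by (metis iso_class_cases)
    have "cont_ext ?W (?T (C, D)) x =
        (\<Sum>p | fst p + snd p = x. ?c C (shape (fst p)) * ?c D (shape (snd p)))"
      by (simp add: qsym_mult_kernel(2))
    also have "\<dots> = (\<Sum>p | fst p + snd p = x. ?K C (fst p) * ?K D (snd p))"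
      by (simp flip: quasisymmetric_expansion[OF quasi])
    also have "\<dots> = ?K (class_union C D) x"
      by (simp add: CD kromatic_disjoint_union)
    finally show "cont_ext ?W (?T (C, D)) x = ?K (class_union C D) x" .
  qed
  have mult: "cont_ext ?K (lc_mult ?H \<phi>) = lc_mult ?Q (cont_ext ?T \<phi>)" for \<phi>
  proof -
    have "cont_ext ?W (cont_ext ?T \<phi>) = cont_ext (\<lambda>p. cont_ext ?W (?T p)) \<phi>"
      by (rule cont_ext_cont_ext(1)[OF column_finite_product[OF c c] qsym_mult_kernel(1)])
    also have "(\<lambda>p. cont_ext ?W (?T p)) = (\<lambda>(C, D). ?K (class_union C D))"
      using mult_kernel by (simp add: fun_eq_iff split_paired_all)
    finally show ?thesis
      by (simp add: cont_ext_mult_mGraphs[OF K] mQSym_def)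
  qed
  have one: "cont_ext ?K (lc_one ?H) = lc_one ?Q"
    by (simp add: cont_ext_delta[OF K] mQSym_def fun_eq_iff kromatic_empty_graph)
  have comult_kernel: "cont_ext ?T (class_coproduct C) (\<alpha>, \<beta>) = ?c C (comp_append \<alpha> \<beta>)" for C \<alpha> \<beta>
  proof (cases C rule: iso_class_cases)
    case (1 G)
    show ?thesis
      by (simp add: 1 cont_ext_eq_pair[OF column_finite_product[OF c c]] std_pair_class_coproduct
          lookup_predual_map[OF column_finite_product[OF c c]] qsym_coeff_kromatic_append)
  qed
  have comult: "lc_comult ?Q (cont_ext ?K b) = cont_ext ?T (lc_comult ?H b)" for b
  proof
    fix q :: "composition \<times> composition"
    obtain \<alpha> \<beta> where q: "q = (\<alpha>, \<beta>)" by fastforce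
    have "cont_ext ?T (lc_comult ?H b) q = cont_ext (\<lambda>C. cont_ext ?T (class_coproduct C)) b q"
      by (simp only: lc_comult_mGraphs
          cont_ext_cont_ext(1)[OF column_finite_class_coproduct column_finite_product[OF c c]])
    also have "\<dots> = cont_ext ?c b (comp_append \<alpha> \<beta>)"
      by (simp only: cont_ext_def[of _ b] q comult_kernel)
    finally show "lc_comult ?Q (cont_ext ?K b) q = cont_ext ?T (lc_comult ?H b) q"
      by (simp only: q qsym_coeff_comult coeff)
  qed
  have single: "?K C (Poly_Mapping.single i n) = zeta_kernel C n" for C i n
    by (cases C rule: iso_class_cases) (simp add: kromatic_single zeta_kernel_eq finite_edges)
  have counit: "lc_counit ?Q (cont_ext ?K b) = lc_counit ?H b" for b
  proof -
    have "?K C 0 = 0 ^ class_order C" for C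
      using single[of C 0 0] by (cases "class_order C = 0") (auto simp: zeta_kernel_eq zero_power_eq)
    then show ?thesis
      by (simp add: mQSym_def lc_counit_mGraphs cont_ext_def kromatic_empty_graph)
  qed
  have zeta: "zeta_Graphs b = zeta_Q (cont_ext ?K b)" for b
    by (simp add: zeta_Graphs_kernel zeta_Q_def fps_eq_iff cont_ext_def single)
  show ?thesis
    unfolding combinatorial_lc_hopf_morphism_def lc_hopf_morphism_def lc_algebra_hom_def
    by (intro conjI allI ballI cont one counit zeta) (simp_all only: tensor mult comult)
qed

theorem proposition3p8:
  shows "combinatorial_lc_hopf_algebra
           (mGraphs :: (graph_class, graph_class \<Rightarrow> 'k, 'k::idom) lc_bialgebra) zeta_Graphs \<and>
         (\<exists>!\<Psi>. combinatorial_lc_hopf_morphism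
           (mGraphs :: (graph_class, graph_class \<Rightarrow> 'k, 'k) lc_bialgebra) zeta_Graphs
           mQSym zeta_Q \<Psi>) \<and>
         (\<forall>\<Psi>. combinatorial_lc_hopf_morphism
           (mGraphs :: (graph_class, graph_class \<Rightarrow> 'k, 'k) lc_bialgebra) zeta_Graphs
           mQSym zeta_Q \<Psi> \<longrightarrow>
           (\<forall>G. \<Psi> (pseudobasis mGraphs (iso_class G)) = kromatic G))"
proof -
  let ?H = "mGraphs :: (graph_class, graph_class \<Rightarrow> 'k, 'k) lc_bialgebra"
  let ?\<Psi> = "cont_ext (kromatic_class :: graph_class \<Rightarrow> 'k series)"
  have "is_lc_module ?H"
    using lc_hopf_algebra_mGraphs unfolding lc_hopf_algebra_def by blast
  then have unique: "\<Psi> = ?\<Psi>" if "combinatorial_lc_hopf_morphism ?H zeta_Graphs mQSym zeta_Q \<Psi>" for \<Psi>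
    using combinatorial_lc_hopf_morphism_unique[OF _ that combinatorial_lc_hopf_morphism_kromatic]
    by (simp add: fun_eq_iff)
  moreover have "?\<Psi> (pseudobasis ?H (iso_class G)) = kromatic G" for G
    by (simp add: pseudobasis_mGraphs cont_ext_delta[OF column_finite_kromatic])
  ultimately show ?thesis
    using combinatorial_lc_hopf_algebra_mGraphs combinatorial_lc_hopf_morphism_kromatic by blast
qed

end
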